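(* Every MTL formula is equivalent to a Boolean combination of formulas of the following three kinds: (1) $\Diamond_{=N}\varphi$ where $\varphi$ is an MTL formula and $N\in\mathbb{Q}_{\ge0}$ with $\mathit{pr}(\varphi)<N-1$; (2) $\Diamond^{-}_{=N}\varphi$ where $\varphi$ is an MTL formula and $N\in\mathbb{Q}_{\ge0}$ with $\mathit{fr}(\varphi)<N-1$; (3) MTL formulas $\varphi$ in which every interval occurring in a temporal operator is bounded.
   Context: Fix a finite set $\boldsymbol{P}$ of atomic propositions; a signal is a function $f:\mathbb{R}\to2^{\boldsymbol{P}}$. MTL formulas: $\varphi::=\mathbf{true}\mid p\mid\varphi\wedge\varphi\mid\neg\varphi\mid \varphi_1\,\mathbf{U}_I\,\varphi_2\mid\varphi_1\,\mathbf{S}_I\,\varphi_2$, with $p\in\boldsymbol{P}$ and $I\subseteq(0,\infty)$ an interval with endpoints in $\mathbb{Q}_{\ge0}\cup\{\infty\}$. Semantics: $f,r\models p$ iff $p\in f(r)$; Booleans as usual; $f,r\models\varphi_1\,\mathbf{U}_I\,\varphi_2$ iff there is $t>r$ with $t-r\in I$, $f,t\models\varphi_2$ and $f,u\models\varphi_1$ for all $r<u<t$; $f,r\models\varphi_1\,\mathbf{S}_I\,\varphi_2$ iff there is $t<r$ with $r-t\in I$, $f,t\models\varphi_2$ and $f,u\models\varphi_1$ for all $t<u<r$. Abbreviations: $\Diamond_I\varphi:=\mathbf{true}\,\mathbf{U}_I\,\varphi$, $\Diamond^{-}_I\varphi:=\mathbf{true}\,\mathbf{S}_I\,\varphi$;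 the subscript $=q$ denotes the interval $\{q\}$. Two MTL formulas are equivalent if they hold at the same points of every signal. Future-reach $\mathit{fr}$ and past-reach $\mathit{pr}$ (values in $\mathbb{Q}_{\ge0}\cup\{\infty\}$) are defined inductively: $\mathit{fr}(p)=\mathit{pr}(p)=\mathit{fr}(\mathbf{true})=\mathit{pr}(\mathbf{true})=0$; $\mathit{fr}(\neg\varphi)=\mathit{fr}(\varphi)$, $\mathit{pr}(\neg\varphi)=\mathit{pr}(\varphi)$; $\mathit{fr}(\varphi\wedge\psi)=\max\{\mathit{fr}(\varphi),\mathit{fr}(\psi)\}$, $\mathit{pr}(\varphi\wedge\psi)=\max\{\mathit{pr}(\varphi),\mathit{pr}(\psi)\}$; and with $n=\inf I$, $m=\sup I$: $\mathit{fr}(\varphi\,\mathbf{U}_I\,\psi)=m+\max\{\mathit{fr}(\varphi),\mathit{fr}(\psi)\}$, $\mathit{pr}(\varphi\,\mathbf{S}_I\,\psi)=m+\max\{\mathit{pr}(\varphi),\mathit{pr}(\psi)\}$, $\mathit{fr}(\varphi\,\mathbf{S}_I\,\psi)=\max\{\mathit{fr}(\varphi),\mathit{fr}(\psi)-n\}$, $\mathit{pr}(\varphi\,\mathbf{U}_I\,\psi)=\max\{\mathit{pr}(\varphi),\mathit{pr}(\psi)-n\}$. *)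

theory Defs
  imports "HOL-Analysis.Analysis"
begin

definition inf_endpoint :: "real set \<Rightarrow> ereal" where
  "inf_endpoint I = Inf (ereal ` I)"

definition sup_endpoint :: "real set \<Rightarrow> ereal" where
  "sup_endpoint I = Sup (ereal ` I)"

text \<open>
  Intervals are non-empty; the infimum of an admissible interval is therefore finite, and
  \<open>\<psi> - n\<close> in the reach functions below never meets \<open>\<infinity> - \<infinity>\<close>. Non-negativity of the endpoints
  follows from \<open>I \<subseteq> {0<..}\<close>.
\<close>

definition mtl_interval :: "real set \<Rightarrow> bool" where
  "mtl_interval I \<longleftrightarrow>
     is_interval I \<and> I \<noteq> {} \<and> I \<subseteq> {0<..} \<and>
     inf_endpoint I \<in> ereal ` \<rat> \<union> {\<infinity>} \<and> sup_endpoint I \<in> ereal ` \<rat> \<union> {\<infinity>}"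

text \<open>
  The datatype admits arbitrary sets of reals as subscripts and arbitrary atoms; the MTL formulas
  over the set of atomic propositions \<open>P\<close> are the members of \<open>mtl P\<close>.
\<close>

datatype 'p fm =
    TT
  | Atom 'p
  | And "'p fm" "'p fm"
  | Neg "'p fm"
  | Until "'p fm" "real set" "'p fm"
  | Since "'p fm" "real set" "'p fm"

inductive_set mtl :: "'p set \<Rightarrow> 'p fm set" for P :: "'p set" where
  TT: "TT \<in> mtl P"
| Atom: "p \<in> P \<Longrightarrow> Atom p \<in> mtl P"
| And: "\<phi> \<in> mtl P \<Longrightarrow> \<psi> \<in> mtl P \<Longrightarrow> And \<phi> \<psi> \<in> mtl P"
| Neg: "\<phi> \<in> mtl P \<Longrightarrow> Neg \<phi> \<in> mtl P"
| Until: "\<phi> \<in> mtl P \<Longrightarrow> \<psi> \<in> mtl P \<Longrightarrow> mtl_interval I \<Longrightarrow> Until \<phi> I \<psi> \<in> mtl P"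
| Since: "\<phi> \<in> mtl P \<Longrightarrow> \<psi> \<in> mtl P \<Longrightarrow> mtl_interval I \<Longrightarrow> Since \<phi> I \<psi> \<in> mtl P"

definition signals :: "'p set \<Rightarrow> (real \<Rightarrow> 'p set) set" where
  "signals P = {f. \<forall>r. f r \<subseteq> P}"

primrec sat :: "(real \<Rightarrow> 'p set) \<Rightarrow> real \<Rightarrow> 'p fm \<Rightarrow> bool" where
  "sat f r TT \<longleftrightarrow> True"
| "sat f r (Atom p) \<longleftrightarrow> p \<in> f r"
| "sat f r (And \<phi> \<psi>) \<longleftrightarrow> sat f r \<phi> \<and> sat f r \<psi>"
| "sat f r (Neg \<phi>) \<longleftrightarrow> \<not> sat f r \<phi>"
| "sat f r (Until \<phi> I \<psi>) \<longleftrightarrow>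
     (\<exists>t. t > r \<and> t - r \<in> I \<and> sat f t \<psi> \<and> (\<forall>u. r < u \<and> u < t \<longrightarrow> sat f u \<phi>))"
| "sat f r (Since \<phi> I \<psi>) \<longleftrightarrow>
     (\<exists>t. t < r \<and> r - t \<in> I \<and> sat f t \<psi> \<and> (\<forall>u. t < u \<and> u < r \<longrightarrow> sat f u \<phi>))"

definition equivalent :: "'p set \<Rightarrow> 'p fm \<Rightarrow> 'p fm \<Rightarrow> bool" where
  "equivalent P \<phi> \<psi> \<longleftrightarrow> (\<forall>f\<in>signals P. \<forall>r. sat f r \<phi> \<longleftrightarrow> sat f r \<psi>)"

definition Dia :: "real set \<Rightarrow> 'p fm \<Rightarrow> 'p fm" where
  "Dia I \<phi> = Until TT I \<phi>"

definition Past_Dia :: "real set \<Rightarrow> 'p fm \<Rightarrow> 'p fm" where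
  "Past_Dia I \<phi> = Since TT I \<phi>"

primrec fr :: "'p fm \<Rightarrow> ereal" where
  "fr TT = 0"
| "fr (Atom p) = 0"
| "fr (And \<phi> \<psi>) = max (fr \<phi>) (fr \<psi>)"
| "fr (Neg \<phi>) = fr \<phi>"
| "fr (Until \<phi> I \<psi>) = sup_endpoint I + max (fr \<phi>) (fr \<psi>)"
| "fr (Since \<phi> I \<psi>) = max (fr \<phi>) (fr \<psi> - inf_endpoint I)"

primrec pr :: "'p fm \<Rightarrow> ereal" where
  "pr TT = 0"
| "pr (Atom p) = 0"
| "pr (And \<phi> \<psi>) = max (pr \<phi>) (pr \<psi>)"
| "pr (Neg \<phi>) = pr \<phi>"
| "pr (Until \<phi> I \<psi>) = max (pr \<phi>) (pr \<psi> - inf_endpoint I)"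
| "pr (Since \<phi> I \<psi>) = sup_endpoint I + max (pr \<phi>) (pr \<psi>)"

primrec bounded_intervals :: "'p fm \<Rightarrow> bool" where
  "bounded_intervals TT \<longleftrightarrow> True"
| "bounded_intervals (Atom p) \<longleftrightarrow> True"
| "bounded_intervals (And \<phi> \<psi>) \<longleftrightarrow> bounded_intervals \<phi> \<and> bounded_intervals \<psi>"
| "bounded_intervals (Neg \<phi>) \<longleftrightarrow> bounded_intervals \<phi>"
| "bounded_intervals (Until \<phi> I \<psi>) \<longleftrightarrow>
     bounded I \<and> bounded_intervals \<phi> \<and> bounded_intervals \<psi>"
| "bounded_intervals (Since \<phi> I \<psi>) \<longleftrightarrow>
     bounded I \<and> bounded_intervals \<phi> \<and> bounded_intervals \<psi>"

inductive_set boolean_combinations :: "'p fm set \<Rightarrow> 'p fm set" for B :: "'p fm set" where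
  base: "\<phi> \<in> B \<Longrightarrow> \<phi> \<in> boolean_combinations B"
| And: "\<phi> \<in> boolean_combinations B \<Longrightarrow> \<psi> \<in> boolean_combinations B \<Longrightarrow>
        And \<phi> \<psi> \<in> boolean_combinations B"
| Neg: "\<phi> \<in> boolean_combinations B \<Longrightarrow> Neg \<phi> \<in> boolean_combinations B"

end

theory Submission
  imports Defs
begin

text \<open>
  Bounded formulas only look at a compact window, and on a window of radius \<open>L\<close> around \<open>r\<close> an
  unbounded \<open>b U c\<close> agrees with a bounded formula once the single bit ``\<open>b U c\<close> at \<open>r + M\<close>'' with
  \<open>M > L\<close> is known. Hence bounded operators may be applied to unbounded ones without leaving the
  Boolean combinations of shifted unbounded operators and bounded formulas. This reduces MTL to
  unbounded until and since over bounded formulas, and also turns an unbounded until whose arguments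
  have finite past-reach into formulas \<open>\<Diamond>\<^sub>=\<^sub>N \<theta>\<close> with arbitrarily large \<open>N\<close>.

  It remains to separate until from since. The step is to pull one \<open>T = x S y\<close> out of an until whose
  arguments are Boolean combinations of \<open>T\<close> and of formulas in a class \<open>C\<close> closed under until: a
  target containing \<open>T\<close> is removed by guessing the start of the last run of \<open>x\<close>, a guard containing
  \<open>T\<close> by expressing failure of the until through the first violation of the guard. Infima of
  violations that are not attained are described by ``arbitrarily soon after'' and ``arbitrarily
  shortly before'', which are expressible with bounded intervals.
\<close>

section \<open>Until and since on the real line\<close>

definition until :: "(real \<Rightarrow> bool) \<Rightarrow> (real \<Rightarrow> bool) \<Rightarrow> real \<Rightarrow> bool" where
  "until a b r \<longleftrightarrow> (\<exists>t>r. b t \<and> (\<forall>u. r < u \<and> u < t \<longrightarrow> a u))"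

definition since :: "(real \<Rightarrow> bool) \<Rightarrow> (real \<Rightarrow> bool) \<Rightarrow> real \<Rightarrow> bool" where
  "since a b r \<longleftrightarrow> (\<exists>t<r. b t \<and> (\<forall>u. t < u \<and> u < r \<longrightarrow> a u))"

definition acc_right :: "(real \<Rightarrow> bool) \<Rightarrow> real \<Rightarrow> bool" where
  "acc_right a r \<longleftrightarrow> (\<forall>t>r. \<exists>u. r < u \<and> u < t \<and> a u)"

definition acc_left :: "(real \<Rightarrow> bool) \<Rightarrow> real \<Rightarrow> bool" where
  "acc_left a r \<longleftrightarrow> (\<forall>t<r. \<exists>u. t < u \<and> u < r \<and> a u)"

lemma acc_right_iff_not_until: "acc_right a r \<longleftrightarrow> \<not> until (\<lambda>u. \<not> a u) (\<lambda>_. True) r"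
  unfolding acc_right_def until_def by blast

lemma until_or: "until a (\<lambda>u. b u \<or> c u) r \<longleftrightarrow> until a b r \<or> until a c r"
  unfolding until_def by blast

lemma acc_right_mono: "acc_right a r \<Longrightarrow> (\<And>u. a u \<Longrightarrow> b u) \<Longrightarrow> acc_right b r"
  unfolding acc_right_def by meson

lemma acc_right_or: "acc_right (\<lambda>u. a u \<or> b u) r \<longleftrightarrow> acc_right a r \<or> acc_right b r"
proof
  assume L: "acc_right (\<lambda>u. a u \<or> b u) r"
  show "acc_right a r \<or> acc_right b r"
  proof (rule ccontr)
    assume n: "\<not> ?thesis"
    obtain s where s: "s > r" "\<And>u. r < u \<Longrightarrow> u < s \<Longrightarrow> \<not> a u"
      using n unfolding acc_right_def by auto
    obtain t where t: "t > r" "\<And>u. r < u \<Longrightarrow> u < t \<Longrightarrow> \<not> b u"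
      using n unfolding acc_right_def by auto
    obtain u where "r < u" "u < min s t" "a u \<or> b u"
      using L s(1) t(1) unfolding acc_right_def by (metis min_less_iff_conj)
    then show False using s(2) t(2) by (meson min_less_iff_conj)
  qed
qed (auto intro: acc_right_mono[where a = a] acc_right_mono[where a = b])

text \<open>The candidate \<open>w\<close> is the infimum of the violations after \<open>r\<close>.
  If it equals \<open>r\<close>, violations accumulate there from the right. Otherwise the guard
  holds strictly between \<open>r\<close> and \<open>w\<close>, and the infimum is either attained
  or approached from above.\<close>

lemma first_violation:
  assumes "r < v" and "\<not> b (v::real)"
  obtains "acc_right (\<lambda>u. \<not> b u) r"
  | w where "r < w" "\<forall>u. r < u \<and> u < w \<longrightarrow> b u" "\<not> b w \<or> acc_right (\<lambda>u. \<not> b u) w"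
proof -
  define V where "V = {u. r < u \<and> \<not> b u}"
  define w where "w = Inf V"
  have ne: "V \<noteq> {}" and bd: "bdd_below V"
    using assms unfolding V_def bdd_below_def by (auto intro: less_imp_le)
  have "r \<le> w" unfolding w_def using ne by (intro cInf_greatest) (auto simp: V_def)
  have b: "b u" if "r < u" "u < w" for u
    using cInf_lower[OF _ bd, of u] that unfolding w_def V_def by force
  have near: "\<exists>u. w \<le> u \<and> u < t \<and> r < u \<and> \<not> b u" if "w < t" for t
  proof -
    obtain u where "u \<in> V" "u < t" using \<open>w < t\<close> cInf_less_iff[OF ne bd] unfolding w_def by blast
    moreover from this have "w \<le> u" using cInf_lower[OF _ bd] unfolding w_def by blast
    ultimately show ?thesis unfolding V_def by blast
  qed
  show ?thesis
  proof (cases "r = w")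
    case True
    then have "acc_right (\<lambda>u. \<not> b u) r" using near unfolding acc_right_def by blast
    then show ?thesis by (rule that(1))
  next
    case False
    then have rw: "r < w" using \<open>r \<le> w\<close> by simp
    have "acc_right (\<lambda>u. \<not> b u) w" if "b w"
      unfolding acc_right_def using near that by (metis order_le_less)
    then show ?thesis using rw b by (intro that(2)[of w]) auto
  qed
qed

text \<open>
  In both expansions of a negated until the guard \<open>b\<close> reappears only in targets and below
  \<open>acc_right\<close>, never as a guard.
\<close>

lemma not_until_iff:
  "\<not> until b q r \<longleftrightarrow> \<not> until (\<lambda>_. True) q r \<or> acc_right (\<lambda>u. \<not> b u) r \<or>
     until (\<lambda>u. \<not> q u) (\<lambda>u. \<not> q u \<and> (\<not> b u \<or> acc_right (\<lambda>u. \<not> b u) u)) r" (is "_ \<longleftrightarrow> ?R")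
proof
  assume L: "\<not> until b q r"
  show ?R
  proof (cases "\<exists>t>r. q t")
    case True
    then obtain v where "r < v" "\<not> b v" using L unfolding until_def by blast
    then show ?thesis
    proof (cases rule: first_violation)
      case 1 then show ?thesis by simp
    next
      case (2 w)
      then have "\<not> q u" if "r < u" "u \<le> w" for u
        using L that unfolding until_def by (meson order_less_le_trans)
      then have "until (\<lambda>u. \<not> q u) (\<lambda>u. \<not> q u \<and> (\<not> b u \<or> acc_right (\<lambda>u. \<not> b u) u)) r"
        using 2 unfolding until_def by (intro exI[of _ w]) auto
      then show ?thesis by simp
    qed
  qed (auto simp: until_def)
next
  assume ?R
  then show "\<not> until b q r"
  proof (elim disjE)
    assume "until (\<lambda>u. \<not> q u) (\<lambda>u. \<not> q u \<and> (\<not> b u \<or> acc_right (\<lambda>u. \<not> b u) u)) r"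
    then obtain v where v: "r < v" "\<forall>u. r < u \<and> u < v \<longrightarrow> \<not> q u" "\<not> q v"
      "\<not> b v \<or> acc_right (\<lambda>u. \<not> b u) v" unfolding until_def by blast
    show ?thesis
    proof
      assume "until b q r"
      \<comment> \<open>Since \<open>q\<close> fails up to and including \<open>v\<close>, the
        witness \<open>t\<close> lies strictly beyond \<open>v\<close>. The violation at
        \<open>v\<close>, or one arbitrarily soon after it, then falls between \<open>r\<close> and
        \<open>t\<close>.\<close>
      then obtain t where t: "r < t" "q t" "\<forall>u. r < u \<and> u < t \<longrightarrow> b u" unfolding until_def by blast
      then have "v < t" using v by (metis linorder_less_linear)
      then show False using v t unfolding acc_right_def by (meson order_less_trans)
    qed
  qed (auto simp: until_def acc_right_def)
qed

lemma not_until_closed_iff: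
  "\<not> until b (\<lambda>u. b u \<and> q u) r \<longleftrightarrow> \<not> until (\<lambda>_. True) q r \<or> acc_right (\<lambda>u. \<not> b u) r \<or>
     until (\<lambda>u. \<not> q u) (\<lambda>u. \<not> b u \<or> (\<not> q u \<and> acc_right (\<lambda>u. \<not> b u) u)) r" (is "_ \<longleftrightarrow> ?R")
proof
  assume L: "\<not> until b (\<lambda>u. b u \<and> q u) r"
  show ?R
  proof (cases "\<exists>t>r. q t")
    case True
    then obtain v where "r < v" "\<not> b v" using L unfolding until_def by blast
    then show ?thesis
    proof (cases rule: first_violation)
      case 1 then show ?thesis by simp
    next
      case (2 w)
      then have "\<not> q u" if "r < u" "u \<le> w" "b u" for u
        using L that unfolding until_def by (meson order_less_le_trans)
      then have "until (\<lambda>u. \<not> q u) (\<lambda>u. \<not> b u \<or> (\<not> q u \<and> acc_right (\<lambda>u. \<not> b u) u)) r"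
        using 2 unfolding until_def by (intro exI[of _ w]) auto
      then show ?thesis by simp
    qed
  qed (auto simp: until_def)
next
  assume ?R
  then show "\<not> until b (\<lambda>u. b u \<and> q u) r"
  proof (elim disjE)
    assume "until (\<lambda>u. \<not> q u) (\<lambda>u. \<not> b u \<or> (\<not> q u \<and> acc_right (\<lambda>u. \<not> b u) u)) r"
    then obtain v where v: "r < v" "\<forall>u. r < u \<and> u < v \<longrightarrow> \<not> q u"
      "\<not> b v \<or> (\<not> q v \<and> acc_right (\<lambda>u. \<not> b u) v)" unfolding until_def by blast
    show ?thesis
    proof
      assume "until b (\<lambda>u. b u \<and> q u) r"
      then obtain t where t: "r < t" "b t" "q t" "\<forall>u. r < u \<and> u < t \<longrightarrow> b u"
        unfolding until_def by blast
      then have "v < t" using v by (metis linorder_less_linear)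
      then show False using v t unfolding acc_right_def by (meson order_less_trans)
    qed
  qed (auto simp: until_def acc_right_def)
qed

text \<open>The past witness lies after \<open>r\<close>, at \<open>r\<close> or before
  \<open>r\<close>. In the last two cases \<open>x\<close> must persist from \<open>r\<close> to
  \<open>t\<close>, and everything the past of \<open>r\<close> contributes is condensed into the
  values of \<open>y\<close>, \<open>x\<close> and \<open>since x y\<close> at
  \<open>r\<close>.\<close>

lemma since_split:
  assumes "r < (t::real)"
  shows "since x y t \<longleftrightarrow> (\<exists>w. r < w \<and> w < t \<and> y w \<and> (\<forall>u. w < u \<and> u < t \<longrightarrow> x u)) \<or>
    (\<forall>u. r < u \<and> u < t \<longrightarrow> x u) \<and> (y r \<or> since x y r \<and> x r)" (is "_ \<longleftrightarrow> ?A \<or> ?B")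
proof
  assume "since x y t"
  then obtain w where w: "w < t" "y w" "\<forall>u. w < u \<and> u < t \<longrightarrow> x u" unfolding since_def by blast
  consider "r < w" | "r = w" | "w < r" by linarith
  then show "?A \<or> ?B"
  proof cases
    case 3
    then have "since x y r" "x r" "\<forall>u. r < u \<and> u < t \<longrightarrow> x u"
      using w assms unfolding since_def by (auto intro!: exI[of _ w])
    then show ?thesis by blast
  qed (use w in blast)+
next
  assume "?A \<or> ?B"
  then show "since x y t"
  proof
    assume ?B
    then have B: "\<forall>u. r < u \<and> u < t \<longrightarrow> x u" "y r \<or> since x y r \<and> x r" by auto
    from B(2) show ?thesis
    proof
      assume "since x y r \<and> x r"
      then obtain w where w: "w < r" "y w" "\<forall>u. w < u \<and> u < r \<longrightarrow> x u" "x r" unfolding since_def by blast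
      then have "x u" if "w < u" "u < t" for u
        using that B(1) by (cases "u < r"; cases "u = r") auto
      then show ?thesis using w assms unfolding since_def by (intro exI[of _ w]) auto
    qed (use B assms in \<open>auto simp: since_def\<close>)
  qed (use assms in \<open>auto simp: since_def\<close>)
qed

text \<open>Going back from \<open>t\<close>, no \<open>y\<close> occurs down to and including
  \<open>w\<close>. An earlier witness would need \<open>x\<close> at \<open>w\<close> and on a left
  neighbourhood of \<open>w\<close>, which the last hypothesis rules out.\<close>

lemma not_since_run:
  assumes "\<forall>u. w < u \<and> u < (t::real) \<longrightarrow> x u \<and> \<not> y u" "w < t" "\<not> y w"
    "\<not> x w \<or> acc_left (\<lambda>u. \<not> x u) w"
  shows "\<not> since x y t"
proof
  assume "since x y t"
  then have "since x y w" "x w" using assms since_split[OF assms(2), of x y] by auto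
  then show False using assms(4) unfolding since_def acc_left_def by blast
qed

text \<open>The cases locate the supremum of the violations of \<open>x\<close> before
  \<open>t\<close>: it is \<open>t\<close> itself, or a point \<open>w\<close> after
  \<open>r\<close> where the last run of \<open>x\<close> starts, or there is no violation between
  \<open>r\<close> and \<open>t\<close>, so that only the values at \<open>r\<close> matter. The run
  must be free of \<open>y\<close>, since any \<open>y\<close> in it would witness the
  since.\<close>

lemma not_since_split:
  assumes "r < (t::real)"
  shows "\<not> since x y t \<longleftrightarrow> acc_left (\<lambda>u. \<not> x u) t \<or>
    (\<exists>w. r < w \<and> w < t \<and> \<not> y w \<and> (\<not> x w \<or> acc_left (\<lambda>u. \<not> x u) w)
       \<and> (\<forall>u. w < u \<and> u < t \<longrightarrow> x u \<and> \<not> y u)) \<or>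
    (\<forall>u. r < u \<and> u < t \<longrightarrow> x u \<and> \<not> y u) \<and> \<not> y r \<and> \<not> (since x y r \<and> x r)"
    (is "_ \<longleftrightarrow> ?A \<or> ?B \<or> ?C")
proof
  assume L: "\<not> since x y t"
  have ny: "\<not> y w" if "\<forall>u. w < u \<and> u < t \<longrightarrow> x u" "w < t" for w
    using L that unfolding since_def by blast
  show "?A \<or> ?B \<or> ?C"
  proof (cases "\<forall>u. r < u \<and> u < t \<longrightarrow> x u")
    case True
    then have "\<forall>u. r < u \<and> u < t \<longrightarrow> x u \<and> \<not> y u" using ny by auto
    then show ?thesis using L since_split[OF assms, of x y] by blast
  next
    case False
    then obtain v where v: "r < v" "v < t" "\<not> x v" by blast
    \<comment> \<open>The last violation before \<open>t\<close> is the first violation after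
      \<open>- t\<close> of the predicate reflected in time, so \<open>first_violation\<close>
      applies to the latter and \<open>- w\<close> becomes the start of the last run.\<close>
    then have "- t < - v" "\<not> x (- (- v))" by auto
    then show ?thesis
    proof (cases rule: first_violation[of "-t" "-v" "\<lambda>u. x (- u)"])
      case 1
      have "acc_left (\<lambda>u. \<not> x u) t" unfolding acc_left_def
      proof (intro allI impI)
        fix s assume "s < t"
        then obtain u where "- t < u" "u < - s" "\<not> x (- u)"
          using 1 unfolding acc_right_def by (metis neg_less_iff_less)
        then show "\<exists>u. s < u \<and> u < t \<and> \<not> x u" by (intro exI[of _ "- u"]) auto
      qed
      then show ?thesis by blast
    next
      case (2 w)
      have x: "\<forall>u. - w < u \<and> u < t \<longrightarrow> x u"
      proof (intro allI impI)
        fix u assume "- w < u \<and> u < t"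
        then show "x u" using 2(2)[rule_format, of "- u"] by auto
      qed
      have acc: "acc_left (\<lambda>u. \<not> x u) (- w)" if ar: "acc_right (\<lambda>u. \<not> x (- u)) w"
        unfolding acc_left_def
      proof (intro allI impI)
        fix s assume "s < - w"
        then have "w < - s" by simp
        then obtain u where "w < u" "u < - s" "\<not> x (- u)"
          using ar unfolding acc_right_def by blast
        then show "\<exists>u. s < u \<and> u < - w \<and> \<not> x u" by (intro exI[of _ "- u"]) auto
      qed
      have "v \<le> - w" using x v by force
      then have "r < - w" using v by auto
      moreover have "\<not> y u" if "- w \<le> u" "u < t" for u using ny[of u] x that by auto
      ultimately have ?B using x acc 2(1,3) by (intro exI[of _ "- w"]) auto
      then show ?thesis by blast
    qed
  qed
next
  assume "?A \<or> ?B \<or> ?C"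
  then show "\<not> since x y t"
  proof (elim disjE)
    assume ?A then show ?thesis unfolding acc_left_def since_def by blast
  next
    assume ?B then show ?thesis using not_since_run by blast
  next
    assume ?C then show ?thesis using since_split[OF assms, of x y] by blast
  qed
qed

text \<open>If \<open>x\<close> fails arbitrarily soon after \<open>r\<close>, the witness of
  \<open>since x y u\<close> must lie between \<open>r\<close> and \<open>u\<close>, so it can be
  guessed as a point \<open>w\<close> and the rest written as an until. Otherwise \<open>x\<close>
  holds just after \<open>r\<close>, and \<open>since x y u\<close> has one constant value for all
  \<open>u\<close> close enough to \<open>r\<close>. Either way, since survives only at
  \<open>r\<close> itself.\<close>

lemma acc_right_since:
  "acc_right (\<lambda>u. since x y u \<and> b u) r \<longleftrightarrow>
    (if acc_right (\<lambda>u. \<not> x u) r then acc_right (\<lambda>w. y w \<and> until x b w) r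
     else acc_right b r \<and> (acc_right y r \<or> y r \<or> since x y r \<and> x r))"
proof (cases "acc_right (\<lambda>u. \<not> x u) r")
  case True
  have "acc_right (\<lambda>u. since x y u \<and> b u) r \<longleftrightarrow> acc_right (\<lambda>w. y w \<and> until x b w) r"
  proof
    assume L: "acc_right (\<lambda>u. since x y u \<and> b u) r"
    show "acc_right (\<lambda>w. y w \<and> until x b w) r"
      unfolding acc_right_def
    proof (intro allI impI)
      fix t assume "r < t"
      then obtain u where u: "r < u" "u < t" "since x y u" "b u"
        using L unfolding acc_right_def by blast
      have "\<not> (\<forall>v. r < v \<and> v < u \<longrightarrow> x v)" using True u(1) unfolding acc_right_def by blast
      then obtain w where "r < w" "w < u" "y w" "\<forall>v. w < v \<and> v < u \<longrightarrow> x v"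
        using u(3) since_split[OF u(1)] by blast
      then show "\<exists>w. r < w \<and> w < t \<and> y w \<and> until x b w"
        using u unfolding until_def by (intro exI[of _ w]) auto
    qed
  next
    assume R: "acc_right (\<lambda>w. y w \<and> until x b w) r"
    show "acc_right (\<lambda>u. since x y u \<and> b u) r"
      unfolding acc_right_def
    proof (intro allI impI)
      fix t assume "r < t"
      then obtain v where v: "r < v" "v < t" "\<not> x v" using True unfolding acc_right_def by blast
      then obtain w where w: "r < w" "w < v" "y w" "until x b w"
        using R unfolding acc_right_def by blast
      then obtain u where u: "w < u" "b u" "\<forall>v. w < v \<and> v < u \<longrightarrow> x v"
        unfolding until_def by blast
      \<comment> \<open>The failure of \<open>x\<close> at \<open>v\<close> stops the run that
        starts at \<open>w\<close>, which keeps the point \<open>u\<close> below the prescribed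
        bound \<open>t\<close>.\<close>
      then have "u \<le> v" using v w by force
      moreover have "since x y u" using u w unfolding since_def by blast
      ultimately show "\<exists>u. r < u \<and> u < t \<and> since x y u \<and> b u"
        using u v w by (intro exI[of _ u]) auto
    qed
  qed
  then show ?thesis using True by simp
next
  case False
  then obtain e where e: "r < e" "\<And>u. r < u \<Longrightarrow> u < e \<Longrightarrow> x u" unfolding acc_right_def by blast
  have sx: "since x y u \<longleftrightarrow> (\<exists>w. r < w \<and> w < u \<and> y w) \<or> y r \<or> since x y r \<and> x r"
    if "r < u" "u < e" for u
    using since_split[OF that(1), of x y] e that by (smt (verit))
  have "acc_right (\<lambda>u. since x y u \<and> b u) r \<longleftrightarrow>
    acc_right b r \<and> (acc_right y r \<or> y r \<or> since x y r \<and> x r)"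
  proof
    assume L: "acc_right (\<lambda>u. since x y u \<and> b u) r"
    have "acc_right y r" if n: "\<not> (y r \<or> since x y r \<and> x r)"
      unfolding acc_right_def
    proof (intro allI impI)
      fix t assume "r < t"
      then obtain u where "r < u" "u < min t e" "since x y u"
        using L e(1) unfolding acc_right_def by (metis min_less_iff_conj)
      then show "\<exists>u. r < u \<and> u < t \<and> y u" using sx[of u] n by auto
    qed
    then show "acc_right b r \<and> (acc_right y r \<or> y r \<or> since x y r \<and> x r)"
      using L acc_right_mono by blast
  next
    assume R: "acc_right b r \<and> (acc_right y r \<or> y r \<or> since x y r \<and> x r)"
    show "acc_right (\<lambda>u. since x y u \<and> b u) r"
      unfolding acc_right_def
    proof (intro allI impI)
      fix t assume "r < t"
      then obtain u where u: "r < u" "u < min t e" "b u"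
        using R e(1) unfolding acc_right_def by (metis min_less_iff_conj)
      then have "since x y u" using sx[of u] R unfolding acc_right_def by auto
      then show "\<exists>u. r < u \<and> u < t \<and> since x y u \<and> b u" using u by auto
    qed
  qed
  then show ?thesis using False by simp
qed

text \<open>The dichotomy is that of \<open>acc_right_since\<close>. In the first branch
  \<open>not_since_split\<close> supplies two ways for since to fail at \<open>u\<close>: violations
  of \<open>x\<close> accumulating at \<open>u\<close> from the left, or a run of \<open>x\<close>
  without \<open>y\<close> starting at some \<open>w\<close>. Its third way is excluded by a
  violation between \<open>r\<close> and \<open>u\<close>.\<close>

lemma acc_right_not_since:
  "acc_right (\<lambda>u. \<not> since x y u \<and> b u) r \<longleftrightarrow>
    (if acc_right (\<lambda>u. \<not> x u) r
     then acc_right (\<lambda>u. acc_left (\<lambda>v. \<not> x v) u \<and> b u) r \<or>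
       acc_right (\<lambda>w. \<not> y w \<and> (\<not> x w \<or> acc_left (\<lambda>v. \<not> x v) w) \<and> until (\<lambda>v. x v \<and> \<not> y v) b w) r
     else acc_right b r \<and> \<not> (acc_right y r \<or> y r \<or> since x y r \<and> x r))"
proof (cases "acc_right (\<lambda>u. \<not> x u) r")
  case True
  let ?z = "\<lambda>w. \<not> y w \<and> (\<not> x w \<or> acc_left (\<lambda>v. \<not> x v) w) \<and> until (\<lambda>v. x v \<and> \<not> y v) b w"
  have "acc_right (\<lambda>u. \<not> since x y u \<and> b u) r \<longleftrightarrow>
    acc_right (\<lambda>u. (acc_left (\<lambda>v. \<not> x v) u \<and> b u) \<or> ?z u) r"
  proof
    assume L: "acc_right (\<lambda>u. \<not> since x y u \<and> b u) r"
    show "acc_right (\<lambda>u. (acc_left (\<lambda>v. \<not> x v) u \<and> b u) \<or> ?z u) r"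
      unfolding acc_right_def
    proof (intro allI impI)
      fix t assume "r < t"
      then obtain u where u: "r < u" "u < t" "\<not> since x y u" "b u"
        using L unfolding acc_right_def by blast
      have "\<not> (\<forall>v. r < v \<and> v < u \<longrightarrow> x v)" using True u(1) unfolding acc_right_def by blast
      then consider "acc_left (\<lambda>v. \<not> x v) u"
        | w where "r < w" "w < u" "\<not> y w" "\<not> x w \<or> acc_left (\<lambda>v. \<not> x v) w"
            "\<forall>v. w < v \<and> v < u \<longrightarrow> x v \<and> \<not> y v"
        using u(3) not_since_split[OF u(1)] by blast
      then show "\<exists>w. r < w \<and> w < t \<and> ((acc_left (\<lambda>v. \<not> x v) w \<and> b w) \<or> ?z w)"
      proof cases
        case (2 w)
        then have "?z w" using u unfolding until_def by blast
        then show ?thesis using 2 u by (intro exI[of _ w]) auto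
      qed (use u in blast)
    qed
  next
    assume R: "acc_right (\<lambda>u. (acc_left (\<lambda>v. \<not> x v) u \<and> b u) \<or> ?z u) r"
    show "acc_right (\<lambda>u. \<not> since x y u \<and> b u) r"
      unfolding acc_right_def
    proof (intro allI impI)
      fix t assume "r < t"
      then obtain v where v: "r < v" "v < t" "\<not> x v" using True unfolding acc_right_def by blast
      then obtain w where w: "r < w" "w < v" "(acc_left (\<lambda>v. \<not> x v) w \<and> b w) \<or> ?z w"
        using R unfolding acc_right_def by blast
      from w(3) show "\<exists>u. r < u \<and> u < t \<and> \<not> since x y u \<and> b u"
      proof
        assume "acc_left (\<lambda>v. \<not> x v) w \<and> b w"
        then show ?thesis using w v not_since_split[OF w(1)] by (intro exI[of _ w]) auto
      next
        assume z: "?z w"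
        then obtain u where u: "w < u" "b u" "\<forall>v. w < v \<and> v < u \<longrightarrow> x v \<and> \<not> y v"
          unfolding until_def by blast
        then have "u \<le> v" using v w by force
        moreover have "\<not> since x y u" using u z not_since_run by blast
        ultimately show ?thesis using u v w by (intro exI[of _ u]) auto
      qed
    qed
  qed
  then show ?thesis using True by (simp add: acc_right_or)
next
  case False
  then obtain e where e: "r < e" "\<And>u. r < u \<Longrightarrow> u < e \<Longrightarrow> x u" unfolding acc_right_def by blast
  have sx: "since x y u \<longleftrightarrow> (\<exists>w. r < w \<and> w < u \<and> y w) \<or> y r \<or> since x y r \<and> x r"
    if "r < u" "u < e" for u
    using since_split[OF that(1), of x y] e that by (smt (verit))
  have "acc_right (\<lambda>u. \<not> since x y u \<and> b u) r \<longleftrightarrow>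
    acc_right b r \<and> \<not> (acc_right y r \<or> y r \<or> since x y r \<and> x r)"
  proof
    assume L: "acc_right (\<lambda>u. \<not> since x y u \<and> b u) r"
    then obtain u where u: "r < u" "u < e" "\<not> since x y u"
      using e(1) unfolding acc_right_def by blast
    then show "acc_right b r \<and> \<not> (acc_right y r \<or> y r \<or> since x y r \<and> x r)"
      using sx[of u] L acc_right_mono[OF L, of b] unfolding acc_right_def by blast
  next
    assume R: "acc_right b r \<and> \<not> (acc_right y r \<or> y r \<or> since x y r \<and> x r)"
    then obtain d where d: "r < d" "\<And>u. r < u \<Longrightarrow> u < d \<Longrightarrow> \<not> y u" unfolding acc_right_def by blast
    show "acc_right (\<lambda>u. \<not> since x y u \<and> b u) r"
      unfolding acc_right_def
    proof (intro allI impI)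
      fix t assume "r < t"
      then obtain u where u: "r < u" "u < min t (min d e)" "b u"
        using R e(1) d(1) unfolding acc_right_def by (metis min_less_iff_conj)
      then have "\<not> since x y u" using sx[of u] R d by auto
      then show "\<exists>u. r < u \<and> u < t \<and> \<not> since x y u \<and> b u" using u by auto
    qed
  qed
  then show ?thesis using False by simp
qed


text \<open>The since at the witness \<open>t\<close> is split at \<open>r\<close>. If its own
  witness \<open>w\<close> comes after \<open>r\<close>, then since holds throughout from
  \<open>w\<close> to \<open>t\<close>, so the guard reduces there to \<open>b1\<close> together
  with \<open>x\<close>. The inner until is thus free of since. The conjunct \<open>b w\<close> is
  required because \<open>w\<close> lies in the range of the outer guard.\<close>

lemma until_since_target:
  fixes x y b1 b2 c :: "real \<Rightarrow> bool"
  defines "b \<equiv> \<lambda>u. if since x y u then b1 u else b2 u"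
  shows "until b (\<lambda>u. since x y u \<and> c u) r \<longleftrightarrow>
    until b (\<lambda>w. b w \<and> y w \<and> until (\<lambda>v. b1 v \<and> x v) c w) r \<or>
    (y r \<or> since x y r \<and> x r) \<and> until (\<lambda>v. b1 v \<and> x v) c r" (is "?L \<longleftrightarrow> ?A \<or> ?B")
proof
  assume ?L
  then obtain t where t: "r < t" "since x y t" "c t" "\<forall>u. r < u \<and> u < t \<longrightarrow> b u"
    unfolding until_def by blast
  consider w where "r < w" "w < t" "y w" "\<forall>u. w < u \<and> u < t \<longrightarrow> x u"
    | "\<forall>u. r < u \<and> u < t \<longrightarrow> x u" "y r \<or> since x y r \<and> x r"
    using t(2) since_split[OF t(1), of x y] by blast
  then show "?A \<or> ?B"
  proof cases
    case (1 w)
    have "since x y u" if "w < u" "u < t" for u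
      using 1 that unfolding since_def by (intro exI[of _ w]) auto
    then have "b1 u" if "w < u" "u < t" for u using t(4) that 1(1) unfolding b_def by force
    then have "until (\<lambda>v. b1 v \<and> x v) c w" using 1 t unfolding until_def by blast
    then have ?A using 1 t unfolding until_def[of b] by (intro exI[of _ w]) auto
    then show ?thesis ..
  next
    case 2
    have "since x y u" if "r < u" "u < t" for u
      using 2 that since_split[OF that(1), of x y] by auto
    then have "b1 u" if "r < u" "u < t" for u using t(4) that unfolding b_def by force
    then have ?B using 2 t unfolding until_def by blast
    then show ?thesis ..
  qed
next
  assume "?A \<or> ?B"
  then show ?L
  proof
    assume ?A
    then obtain w t where w: "r < w" "b w" "y w" "\<forall>u. r < u \<and> u < w \<longrightarrow> b u"
      and t: "w < t" "c t" "\<forall>u. w < u \<and> u < t \<longrightarrow> b1 u \<and> x u" unfolding until_def by blast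
    have s: "since x y u" if "w < u" "u \<le> t" for u
      using w t that unfolding since_def by (intro exI[of _ w]) auto
    have "b u" if "r < u" "u < t" for u
      using s[of u] w t that unfolding b_def by (cases u w rule: linorder_cases) auto
    then show ?L using s[of t] w t unfolding until_def by (intro exI[of _ t]) auto
  next
    assume B: ?B
    then obtain t where t: "r < t" "c t" "\<forall>u. r < u \<and> u < t \<longrightarrow> b1 u \<and> x u" unfolding until_def by blast
    have s: "since x y u" if "r < u" "u \<le> t" for u
      using since_split[OF that(1), of x y] B t that by auto
    then show ?L using s[of t] t unfolding until_def b_def by (intro exI[of _ t]) auto
  qed
qed

text \<open>The three disjuncts mirror the cases of \<open>not_since_split\<close> at the witness:
  violations of \<open>x\<close> accumulate there, the last run starts at a guessed
  \<open>w\<close>, or it covers everything back to \<open>r\<close>. Within the run since is false,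
  so the guard reduces to \<open>b2\<close>.\<close>

lemma until_not_since_target:
  fixes x y b1 b2 c :: "real \<Rightarrow> bool"
  defines "b \<equiv> \<lambda>u. if since x y u then b1 u else b2 u"
    and "k \<equiv> acc_left (\<lambda>v. \<not> x v)"
  shows "until b (\<lambda>u. \<not> since x y u \<and> c u) r \<longleftrightarrow>
    until b (\<lambda>u. k u \<and> c u) r \<or>
    until b (\<lambda>w. b w \<and> \<not> y w \<and> (\<not> x w \<or> k w) \<and> until (\<lambda>v. b2 v \<and> x v \<and> \<not> y v) c w) r \<or>
    \<not> (y r \<or> since x y r \<and> x r) \<and> until (\<lambda>v. b2 v \<and> x v \<and> \<not> y v) c r"
    (is "?L \<longleftrightarrow> ?K \<or> ?A \<or> ?B")
proof
  assume ?L
  then obtain t where t: "r < t" "\<not> since x y t" "c t" "\<forall>u. r < u \<and> u < t \<longrightarrow> b u"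
    unfolding until_def by blast
  consider "k t"
    | w where "r < w" "w < t" "\<not> y w" "\<not> x w \<or> k w" "\<forall>u. w < u \<and> u < t \<longrightarrow> x u \<and> \<not> y u"
    | "\<forall>u. r < u \<and> u < t \<longrightarrow> x u \<and> \<not> y u" "\<not> (y r \<or> since x y r \<and> x r)"
    using t(2) not_since_split[OF t(1), of x y] unfolding k_def by blast
  then show "?K \<or> ?A \<or> ?B"
  proof cases
    case 1
    then have ?K using t unfolding until_def by (intro exI[of _ t]) auto
    then show ?thesis ..
  next
    case (2 w)
    have "\<not> since x y u" if "w < u" "u < t" for u
      using 2 that unfolding k_def by (intro not_since_run[of w]) auto
    then have "b2 u" if "w < u" "u < t" for u using t(4) that 2(1) unfolding b_def by force
    then have "until (\<lambda>v. b2 v \<and> x v \<and> \<not> y v) c w" using 2 t unfolding until_def by blast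
    then have ?A using 2 t unfolding until_def[of b] by (intro exI[of _ w]) auto
    then show ?thesis by blast
  next
    case 3
    have "\<not> since x y u" if "r < u" "u < t" for u
      using 3 that since_split[OF that(1), of x y] by auto
    then have "b2 u" if "r < u" "u < t" for u using t(4) that unfolding b_def by force
    then have ?B using 3 t unfolding until_def by blast
    then show ?thesis by blast
  qed
next
  assume "?K \<or> ?A \<or> ?B"
  then show ?L
  proof (elim disjE)
    assume ?K
    then obtain t where "r < t" "k t" "c t" "\<forall>u. r < u \<and> u < t \<longrightarrow> b u" unfolding until_def by blast
    then show ?L using not_since_split[of r t x y] unfolding until_def k_def
      by (intro exI[of _ t]) auto
  next
    assume ?A
    then obtain w t where w: "r < w" "b w" "\<not> y w" "\<not> x w \<or> k w" "\<forall>u. r < u \<and> u < w \<longrightarrow> b u"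
      and t: "w < t" "c t" "\<forall>u. w < u \<and> u < t \<longrightarrow> b2 u \<and> x u \<and> \<not> y u" unfolding until_def by blast
    have s: "\<not> since x y u" if "w < u" "u \<le> t" for u
      using w t that unfolding k_def by (intro not_since_run[of w]) auto
    have "b u" if "r < u" "u < t" for u
      using s[of u] w t that unfolding b_def by (cases u w rule: linorder_cases) auto
    then show ?L using s[of t] w t unfolding until_def by (intro exI[of _ t]) auto
  next
    assume B: ?B
    then obtain t where t: "r < t" "c t" "\<forall>u. r < u \<and> u < t \<longrightarrow> b2 u \<and> x u \<and> \<not> y u"
      unfolding until_def by blast
    have s: "\<not> since x y u" if "r < u" "u \<le> t" for u
      using since_split[OF that(1), of x y] B t that by auto
    then show ?L using s[of t] t unfolding until_def b_def by (intro exI[of _ t]) auto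
  qed
qed

section \<open>Adjoining one since formula\<close>

text \<open>Formulas are represented by their truth functions. Equivalence becomes equality, and a
  class of formulas closed under equivalence becomes a plain set.\<close>

type_synonym 'p sem = "(real \<Rightarrow> 'p set) \<Rightarrow> real \<Rightarrow> bool"

locale bool_closed =
  fixes C :: "'p sem set"
  assumes tt: "(\<lambda>f r. True) \<in> C"
    and neg: "p \<in> C \<Longrightarrow> (\<lambda>f r. \<not> p f r) \<in> C"
    and conj: "p \<in> C \<Longrightarrow> q \<in> C \<Longrightarrow> (\<lambda>f r. p f r \<and> q f r) \<in> C"
begin

lemma disj: "p \<in> C \<Longrightarrow> q \<in> C \<Longrightarrow> (\<lambda>f r. p f r \<or> q f r) \<in> C"
  using neg[OF conj[OF neg neg], of p q] by simp

lemma cond: "p \<in> C \<Longrightarrow> q \<in> C \<Longrightarrow> s \<in> C \<Longrightarrow> (\<lambda>f r. if p f r then q f r else s f r) \<in> C"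
  using disj[OF conj conj[OF neg], of p q p s] by (simp add: if_bool_eq_disj)

lemmas bool_intros = neg conj disj cond

end

locale until_closed = bool_closed +
  assumes until: "p \<in> C \<Longrightarrow> q \<in> C \<Longrightarrow> (\<lambda>f r. until (p f) (q f) r) \<in> C"
begin

lemma acc_right: "p \<in> C \<Longrightarrow> (\<lambda>f r. acc_right (p f) r) \<in> C"
  unfolding acc_right_iff_not_until by (intro neg until tt)

end

text \<open>Closure under until gives right limits by \<open>acc_right\<close>, but the left limit
  of violations of \<open>x\<close> looks into the past and is therefore an assumption of its
  own.\<close>

locale adjoin_since = until_closed +
  fixes x y :: "'a sem"
  assumes x: "x \<in> C" and y: "y \<in> C" and acc_left_x: "(\<lambda>f r. acc_left (\<lambda>u. \<not> x f u) r) \<in> C"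
begin

text \<open>This is the Boolean closure of \<open>C\<close> with the one new predicate
  \<open>since x y\<close>, written as a Shannon expansion: each member is given by its two
  restrictions to \<open>C\<close>.\<close>

definition D :: "'a sem set" where
  "D = {\<lambda>f r. if since (x f) (y f) r then p f r else q f r | p q. p \<in> C \<and> q \<in> C}"

lemma D_I: "p \<in> C \<Longrightarrow> q \<in> C \<Longrightarrow> (\<lambda>f r. if since (x f) (y f) r then p f r else q f r) \<in> D"
  unfolding D_def by blast

lemma C_sub_D: "p \<in> C \<Longrightarrow> p \<in> D"
  using D_I[of p p] by simp

lemma since_D: "(\<lambda>f r. since (x f) (y f) r) \<in> D"
  using D_I[OF tt neg[OF tt]] by (simp add: if_bool_eq_disj)

lemma D_cases:
  assumes "d \<in> D"
  obtains p q where "p \<in> C" "q \<in> C" "d = (\<lambda>f r. if since (x f) (y f) r then p f r else q f r)"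
  using assms unfolding D_def by blast

sublocale D: bool_closed D
proof
  fix d assume "d \<in> D"
  then show "(\<lambda>f r. \<not> d f r) \<in> D"
  proof (cases rule: D_cases)
    case (1 p q)
    then show ?thesis using D_I[OF neg neg, of p q] by (simp add: if_distrib[of Not])
  qed
next
  fix d e assume "d \<in> D" and "e \<in> D"
  obtain p q where p: "p \<in> C" "q \<in> C"
    and d: "d = (\<lambda>f r. if since (x f) (y f) r then p f r else q f r)"
    using \<open>d \<in> D\<close> by (rule D_cases)
  obtain p' q' where p': "p' \<in> C" "q' \<in> C"
    and e: "e = (\<lambda>f r. if since (x f) (y f) r then p' f r else q' f r)"
    using \<open>e \<in> D\<close> by (rule D_cases)
  from p p' have "(\<lambda>f r. if since (x f) (y f) r then p f r \<and> p' f r else q f r \<and> q' f r) \<in> D"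
    by (intro D_I conj)
  also have "(\<lambda>f r. if since (x f) (y f) r then p f r \<and> p' f r else q f r \<and> q' f r) =
    (\<lambda>f r. d f r \<and> e f r)" unfolding d e by auto
  finally show "(\<lambda>f r. d f r \<and> e f r) \<in> D" .
qed (intro C_sub_D tt)

section \<open>Closure of the enlarged class under until\<close>

lemma D_split:
  "(if since (x f) (y f) r then p else q) \<longleftrightarrow> (since (x f) (y f) r \<and> p) \<or> (\<not> since (x f) (y f) r \<and> q)"
  by simp

lemma acc_right_D:
  assumes "d \<in> D"
  shows "(\<lambda>f r. acc_right (d f) r) \<in> D"
  using assms
proof (cases rule: D_cases)
  case (1 p q)
  show ?thesis
    unfolding 1(3) D_split acc_right_or acc_right_since acc_right_not_since
    by (intro D.bool_intros since_D C_sub_D acc_right until bool_intros x y acc_left_x 1)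
qed

text \<open>With both branches of the guard equal to \<open>g\<close>, the case distinction in the
  two target lemmas collapses to \<open>g\<close>. Every remaining until then has both arguments in
  \<open>C\<close>, and since occurs only at the point of evaluation.\<close>

lemma until_guard_C:
  assumes "g \<in> C" "d \<in> D"
  shows "(\<lambda>f r. until (g f) (d f) r) \<in> D"
  using assms(2)
proof (cases rule: D_cases)
  case (1 p q)
  have "(\<lambda>f r. until (g f) (d f) r) = (\<lambda>f r.
    until (g f) (\<lambda>w. g f w \<and> y f w \<and> until (\<lambda>v. g f v \<and> x f v) (p f) w) r \<or>
    (y f r \<or> since (x f) (y f) r \<and> x f r) \<and> until (\<lambda>v. g f v \<and> x f v) (p f) r \<or>
    until (g f) (\<lambda>u. acc_left (\<lambda>v. \<not> x f v) u \<and> q f u) r \<or>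
    until (g f) (\<lambda>w. g f w \<and> \<not> y f w \<and> (\<not> x f w \<or> acc_left (\<lambda>v. \<not> x f v) w) \<and>
      until (\<lambda>v. g f v \<and> x f v \<and> \<not> y f v) (q f) w) r \<or>
    \<not> (y f r \<or> since (x f) (y f) r \<and> x f r) \<and> until (\<lambda>v. g f v \<and> x f v \<and> \<not> y f v) (q f) r)"
    (is "?l = ?r")
  proof (intro ext)
    fix f r
    show "?l f r = ?r f r"
      unfolding 1(3) D_split until_or
        until_since_target[of "x f" "y f" "g f" "g f", unfolded if_cancel]
        until_not_since_target[of "x f" "y f" "g f" "g f", unfolded if_cancel]
      by blast
  qed
  also have "\<dots> \<in> D"
    by (intro D.bool_intros since_D C_sub_D acc_right until bool_intros x y acc_left_x 1 assms(1))
  finally show ?thesis .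
qed

text \<open>The expansion of the negated until moves \<open>d\<close> out of the guard into targets
  and below \<open>acc_right\<close>. The new guard comes from \<open>q\<close> and lies in
  \<open>C\<close>, so the case of a guard in \<open>C\<close> applies.\<close>

lemma until_target_C:
  assumes "d \<in> D" "q \<in> C"
  shows "(\<lambda>f r. until (d f) (q f) r) \<in> D"
proof -
  have "(\<lambda>f r. until (d f) (q f) r) = (\<lambda>f r. \<not> (\<not> until (\<lambda>_. True) (q f) r \<or>
    acc_right (\<lambda>u. \<not> d f u) r \<or>
    until (\<lambda>u. \<not> q f u) (\<lambda>u. \<not> q f u \<and> (\<not> d f u \<or> acc_right (\<lambda>u. \<not> d f u) u)) r))"
    by (intro ext, subst not_until_iff[symmetric], rule not_not[symmetric])
  also have "\<dots> \<in> D"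
    by (intro D.bool_intros until_guard_C acc_right_D assms C_sub_D[OF assms(2)] neg tt C_sub_D[OF tt])
  finally show ?thesis .
qed

text \<open>Guessing the start of a run puts the guard into the target as well, because that start
  is an inner point of the outer until. This variant covers such targets.\<close>

lemma until_closed_target_C:
  assumes "d \<in> D" "q \<in> C"
  shows "(\<lambda>f r. until (d f) (\<lambda>u. d f u \<and> q f u) r) \<in> D"
proof -
  have "(\<lambda>f r. until (d f) (\<lambda>u. d f u \<and> q f u) r) = (\<lambda>f r. \<not> (\<not> until (\<lambda>_. True) (q f) r \<or>
    acc_right (\<lambda>u. \<not> d f u) r \<or>
    until (\<lambda>u. \<not> q f u) (\<lambda>u. \<not> d f u \<or> (\<not> q f u \<and> acc_right (\<lambda>u. \<not> d f u) u)) r))"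
    by (intro ext, subst not_until_closed_iff[symmetric], rule not_not[symmetric])
  also have "\<dots> \<in> D"
    by (intro D.bool_intros until_guard_C acc_right_D assms C_sub_D[OF assms(2)] neg tt C_sub_D[OF tt])
  finally show ?thesis .
qed

text \<open>First the target is freed from since by the two target lemmas. What remains are untils
  with guard \<open>d\<close> whose targets lie in \<open>C\<close>, possibly conjoined with
  \<open>d\<close>, and these are the two forms treated just before.\<close>

sublocale D: until_closed D
proof
  fix d e assume d: "d \<in> D" and e: "e \<in> D"
  obtain b1 b2 where b: "b1 \<in> C" "b2 \<in> C" "d = (\<lambda>f r. if since (x f) (y f) r then b1 f r else b2 f r)"
    using d by (rule D_cases)
  obtain c1 c2 where c: "c1 \<in> C" "c2 \<in> C" "e = (\<lambda>f r. if since (x f) (y f) r then c1 f r else c2 f r)"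
    using e by (rule D_cases)
  have "(\<lambda>f r. until (d f) (e f) r) = (\<lambda>f r.
    (until (d f) (\<lambda>w. d f w \<and> y f w \<and> until (\<lambda>v. b1 f v \<and> x f v) (c1 f) w) r \<or>
    (y f r \<or> since (x f) (y f) r \<and> x f r) \<and> until (\<lambda>v. b1 f v \<and> x f v) (c1 f) r) \<or>
    (until (d f) (\<lambda>u. acc_left (\<lambda>v. \<not> x f v) u \<and> c2 f u) r \<or>
    until (d f) (\<lambda>w. d f w \<and> \<not> y f w \<and> (\<not> x f w \<or> acc_left (\<lambda>v. \<not> x f v) w) \<and>
      until (\<lambda>v. b2 f v \<and> x f v \<and> \<not> y f v) (c2 f) w) r \<or>
    \<not> (y f r \<or> since (x f) (y f) r \<and> x f r) \<and> until (\<lambda>v. b2 f v \<and> x f v \<and> \<not> y f v) (c2 f) r))"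
    (is "?l = ?r")
  proof (intro ext)
    fix f r
    have ef: "e f = (\<lambda>u. (since (x f) (y f) u \<and> c1 f u) \<or> (\<not> since (x f) (y f) u \<and> c2 f u))"
      unfolding c(3) D_split ..
    show "?l f r = ?r f r"
      unfolding ef until_or b(3) until_since_target until_not_since_target ..
  qed
  also have "\<dots> \<in> D"
    by (intro D.disj D.conj[of "\<lambda>f r. _ f r \<or> _ f r"] D.conj[of "\<lambda>f r. \<not> _ f r"] D.neg
        until_closed_target_C until_target_C since_D d C_sub_D[OF x] C_sub_D[OF y] C_sub_D[OF until]
        D.conj[OF since_D] bool_intros until x y acc_left_x b c)
  finally show "(\<lambda>f r. until (d f) (e f) r) \<in> D" .
qed

end

section \<open>Boolean combinations\<close>

inductive_set bool_closure :: "'p sem set \<Rightarrow> 'p sem set" for G :: "'p sem set" where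
  base: "p \<in> G \<Longrightarrow> p \<in> bool_closure G"
| top: "(\<lambda>f r. True) \<in> bool_closure G"
| compl: "p \<in> bool_closure G \<Longrightarrow> (\<lambda>f r. \<not> p f r) \<in> bool_closure G"
| inter: "p \<in> bool_closure G \<Longrightarrow> q \<in> bool_closure G \<Longrightarrow> (\<lambda>f r. p f r \<and> q f r) \<in> bool_closure G"

interpretation bool_closure: bool_closed "bool_closure G" for G
  by unfold_locales (auto intro: bool_closure.intros)

lemma bool_closure_least:
  assumes "bool_closed C" "G \<subseteq> C"
  shows "bool_closure G \<subseteq> C"
proof
  interpret bool_closed C by fact
  fix p assume "p \<in> bool_closure G"
  then show "p \<in> C" by induction (use assms(2) tt neg conj in auto)
qed

lemma bool_closure_superset: "G \<subseteq> bool_closure G"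
  by (auto intro: bool_closure.base)

lemma bool_closure_subset_bool_closure: "G \<subseteq> bool_closure H \<Longrightarrow> bool_closure G \<subseteq> bool_closure H"
  by (intro bool_closure_least bool_closure.bool_closed_axioms)

lemma bool_closure_mono: "G \<subseteq> H \<Longrightarrow> bool_closure G \<subseteq> bool_closure H"
  using bool_closure_superset by (blast intro: bool_closure_subset_bool_closure[THEN subsetD])

lemma bool_closure_image:
  assumes "p \<in> bool_closure G" "\<And>p. p \<in> G \<Longrightarrow> (\<lambda>f r. p (g f) (h r)) \<in> C" "bool_closed C"
  shows "(\<lambda>f r. p (g f) (h r)) \<in> C"
proof -
  interpret bool_closed C by fact
  show ?thesis using assms(1) by induction (use assms(2) tt neg conj in auto)
qed

text \<open>A Boolean combination mentions only finitely many generators, which is why since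
  predicates can later be adjoined one at a time.\<close>

lemma bool_closure_finite_support:
  assumes "p \<in> bool_closure (G \<union> H)"
  obtains H' where "finite H'" "H' \<subseteq> H" "p \<in> bool_closure (G \<union> H')"
proof -
  have "\<exists>H'. finite H' \<and> H' \<subseteq> H \<and> p \<in> bool_closure (G \<union> H')" using assms
  proof induction
    case (base p)
    then show ?case by (intro exI[of _ "{p} \<inter> H"]) (auto intro: bool_closure.base)
  next
    case top
    then show ?case by (auto intro: bool_closure.tt)
  next
    case (compl p)
    then show ?case by (auto intro: bool_closure.neg)
  next
    case (inter p q)
    then obtain H1 H2 where H: "finite H1" "H1 \<subseteq> H" "p \<in> bool_closure (G \<union> H1)" "finite H2" "H2 \<subseteq> H" "q \<in> bool_closure (G \<union> H2)"
      by blast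
    moreover have "bool_closure (G \<union> H1) \<subseteq> bool_closure (G \<union> (H1 \<union> H2))" "bool_closure (G \<union> H2) \<subseteq> bool_closure (G \<union> (H1 \<union> H2))"
      by (intro bool_closure_mono; auto)+
    ultimately show ?case by (intro exI[of _ "H1 \<union> H2"]) (auto intro: bool_closure.conj)
  qed
  then show ?thesis using that by blast
qed

section \<open>Time reversal\<close>

text \<open>Signal and evaluation point are reflected together. The result is an involution that
  exchanges until with since, so statements about the past follow from those about the
  future.\<close>

definition reversal :: "'p sem \<Rightarrow> 'p sem" where
  "reversal p = (\<lambda>f r. p (\<lambda>t. f (- t)) (- r))"

lemma reversal_reversal [simp]: "reversal (reversal p) = p"
  unfolding reversal_def by simp

lemma reversal_image_image [simp]: "reversal ` reversal ` C = C"
  by (simp add: image_image)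

lemma in_reversal_image_iff: "p \<in> reversal ` C \<longleftrightarrow> reversal p \<in> C"
  by (metis image_iff reversal_reversal)

lemma bool_closed_reversal:
  assumes "bool_closed C"
  shows "bool_closed (reversal ` C)"
proof -
  interpret bool_closed C by fact
  show ?thesis
    by unfold_locales (use tt neg conj in \<open>auto simp: in_reversal_image_iff reversal_def\<close>)
qed

lemma reversal_bool_closure: "reversal ` bool_closure G = bool_closure (reversal ` G)"
proof -
  have sub: "reversal ` bool_closure H \<subseteq> bool_closure (reversal ` H)" for H :: "'a sem set"
  proof -
    have "bool_closure H \<subseteq> reversal ` bool_closure (reversal ` H)"
      by (intro bool_closure_least bool_closed_reversal bool_closure.bool_closed_axioms)
        (auto simp: in_reversal_image_iff intro!: bool_closure.base)
    then show ?thesis by (auto simp: in_reversal_image_iff)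
  qed
  have "bool_closure (reversal ` G) \<subseteq> reversal ` bool_closure G"
    using image_mono[OF sub[of "reversal ` G"], of reversal] by simp
  with sub show ?thesis by blast
qed

section \<open>Interval-restricted operators and their exchange under time reversal\<close>

definition until_in :: "real set \<Rightarrow> (real \<Rightarrow> bool) \<Rightarrow> (real \<Rightarrow> bool) \<Rightarrow> real \<Rightarrow> bool" where
  "until_in I a b r \<longleftrightarrow> (\<exists>t>r. t - r \<in> I \<and> b t \<and> (\<forall>u. r < u \<and> u < t \<longrightarrow> a u))"

definition since_in :: "real set \<Rightarrow> (real \<Rightarrow> bool) \<Rightarrow> (real \<Rightarrow> bool) \<Rightarrow> real \<Rightarrow> bool" where
  "since_in I a b r \<longleftrightarrow> (\<exists>t<r. r - t \<in> I \<and> b t \<and> (\<forall>u. t < u \<and> u < r \<longrightarrow> a u))"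

lemma neg_interval_reflect:
  "(\<forall>u. t < u \<and> u < (r::real) \<longrightarrow> a (- u)) \<longleftrightarrow> (\<forall>u. - r < u \<and> u < - t \<longrightarrow> a u)"
  by (metis minus_less_iff minus_minus neg_less_iff_less)

lemma since_in_reflect: "since_in I (\<lambda>u. a (- u)) (\<lambda>u. b (- u)) r \<longleftrightarrow> until_in I a b (- r)"
proof
  assume "since_in I (\<lambda>u. a (- u)) (\<lambda>u. b (- u)) r"
  then obtain t where "t < r" "r - t \<in> I" "b (- t)" "\<forall>u. t < u \<and> u < r \<longrightarrow> a (- u)"
    unfolding since_in_def by blast
  then show "until_in I a b (- r)"
    unfolding until_in_def neg_interval_reflect by (intro exI[of _ "- t"]) auto
next
  assume "until_in I a b (- r)"
  then obtain t where "t > - r" "t + r \<in> I" "b t" "\<forall>u. - r < u \<and> u < - (- t) \<longrightarrow> a u"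
    unfolding until_in_def by auto
  then show "since_in I (\<lambda>u. a (- u)) (\<lambda>u. b (- u)) r"
    unfolding since_in_def neg_interval_reflect[symmetric] by (intro exI[of _ "- t"]) (auto simp: add.commute)
qed

lemma until_iff_until_in: "until a b r \<longleftrightarrow> until_in {0<..} a b r"
  unfolding until_def until_in_def by auto

lemma since_iff_since_in: "since a b r \<longleftrightarrow> since_in {0<..} a b r"
  unfolding since_def since_in_def by auto

lemma reversal_until_in:
  "reversal (\<lambda>f r. until_in I (p f) (q f) r) = (\<lambda>f r. since_in I (reversal p f) (reversal q f) r)"
  unfolding reversal_def since_in_reflect ..

lemma reversal_since_in:
  "reversal (\<lambda>f r. since_in I (p f) (q f) r) = (\<lambda>f r. until_in I (reversal p f) (reversal q f) r)"
  using reversal_until_in[of I "reversal p" "reversal q"] by (metis reversal_reversal)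

lemma reversal_until:
  "reversal (\<lambda>f r. until (p f) (q f) r) = (\<lambda>f r. since (reversal p f) (reversal q f) r)"
  unfolding until_iff_until_in since_iff_since_in by (rule reversal_until_in)

lemma reversal_since:
  "reversal (\<lambda>f r. since (p f) (q f) r) = (\<lambda>f r. until (reversal p f) (reversal q f) r)"
  unfolding until_iff_until_in since_iff_since_in by (rule reversal_since_in)

text \<open>Only points just after \<open>r\<close> matter, so the interval may be cut off at an
  arbitrary positive length, here 1. This turns the right limit into a bounded operator.\<close>

lemma acc_right_iff_not_until_in: "acc_right a r \<longleftrightarrow> \<not> until_in {0<..1} (\<lambda>u. \<not> a u) (\<lambda>_. True) r"
proof
  assume "acc_right a r"
  then show "\<not> until_in {0<..1} (\<lambda>u. \<not> a u) (\<lambda>_. True) r"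
    unfolding acc_right_def until_in_def by blast
next
  assume R: "\<not> until_in {0<..1} (\<lambda>u. \<not> a u) (\<lambda>_. True) r"
  show "acc_right a r" unfolding acc_right_def
  proof (intro allI impI)
    fix t assume "r < t"
    then have "min t (r + 1) > r" "min t (r + 1) - r \<in> {0<..1}" by auto
    then obtain u where "r < u" "u < min t (r + 1)" "a u" using R unfolding until_in_def by blast
    then show "\<exists>u. r < u \<and> u < t \<and> a u" by auto
  qed
qed

lemma acc_left_iff_not_since_in: "acc_left a r \<longleftrightarrow> \<not> since_in {0<..1} (\<lambda>u. \<not> a u) (\<lambda>_. True) r"
proof -
  have "acc_left a r \<longleftrightarrow> acc_right (\<lambda>u. a (- u)) (- r)"
  proof
    assume L: "acc_left a r"
    show "acc_right (\<lambda>u. a (- u)) (- r)" unfolding acc_right_def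
    proof (intro allI impI)
      fix t assume "- r < t"
      then have "- t < r" by simp
      then obtain u where "- t < u" "u < r" "a u" using L unfolding acc_left_def by blast
      then show "\<exists>u>- r. u < t \<and> a (- u)" by (intro exI[of _ "- u"]) auto
    qed
  next
    assume R: "acc_right (\<lambda>u. a (- u)) (- r)"
    show "acc_left a r" unfolding acc_left_def
    proof (intro allI impI)
      fix t assume "t < r"
      then have "- r < - t" by simp
      then obtain u where "- r < u" "u < - t" "a (- u)" using R unfolding acc_right_def by blast
      then show "\<exists>u>t. u < r \<and> a u" by (intro exI[of _ "- u"]) auto
    qed
  qed
  also have "\<dots> \<longleftrightarrow> \<not> since_in {0<..1} (\<lambda>u. \<not> a u) (\<lambda>_. True) r"
    unfolding acc_right_iff_not_until_in by (simp flip: since_in_reflect)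
  finally show ?thesis .
qed

section \<open>Intervals\<close>

lemma mtl_interval_singleton: "q \<in> \<rat> \<Longrightarrow> q > 0 \<Longrightarrow> mtl_interval {q}"
  unfolding mtl_interval_def inf_endpoint_def sup_endpoint_def by (auto simp: is_interval_1)

lemma mtl_interval_Ioc:
  assumes "q \<in> \<rat>" "q > 0"
  shows "mtl_interval {0<..q}"
proof -
  have "Inf (ereal ` {0<..q}) = ereal 0"
  proof (rule antisym)
    show "Inf (ereal ` {0<..q}) \<le> ereal 0"
    proof (rule ereal_le_epsilon2)
      fix e :: real assume "0 < e"
      then have "ereal (min e q) \<in> ereal ` {0<..q}" using assms by (intro imageI) auto
      then have "Inf (ereal ` {0<..q}) \<le> ereal (min e q)" by (rule Inf_lower)
      also have "\<dots> \<le> ereal 0 + ereal e" by simp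
      finally show "Inf (ereal ` {0<..q}) \<le> ereal 0 + ereal e" .
    qed
  qed (auto intro!: Inf_greatest)
  moreover have "Sup (ereal ` {0<..q}) = ereal q"
    by (rule antisym) (use assms in \<open>auto intro!: Sup_least Sup_upper\<close>)
  ultimately show ?thesis
    using assms Rats_0 unfolding mtl_interval_def inf_endpoint_def sup_endpoint_def by (auto simp: is_interval_1)
qed

lemma mtl_interval_Ioi: assumes "q \<in> \<rat>" "q \<ge> 0" shows "mtl_interval {q<..}"
proof -
  have "Inf (ereal ` {q<..}) = ereal q"
  proof (rule antisym)
    show "Inf (ereal ` {q<..}) \<le> ereal q"
    proof (rule ereal_le_epsilon2)
      fix e :: real assume "0 < e"
      then have "ereal (q + e) \<in> ereal ` {q<..}" by (intro imageI) auto
      then have "Inf (ereal ` {q<..}) \<le> ereal (q + e)" by (rule Inf_lower)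
      then show "Inf (ereal ` {q<..}) \<le> ereal q + ereal e" by simp
    qed
  qed (auto intro!: Inf_greatest)
  moreover have "Sup (ereal ` {q<..}) = \<infinity>"
  proof (rule ereal_top)
    fix B :: real
    have "ereal (max B q + 1) \<in> ereal ` {q<..}" by (intro imageI) auto
    then have "ereal (max B q + 1) \<le> Sup (ereal ` {q<..})" by (rule Sup_upper)
    moreover have "ereal B \<le> ereal (max B q + 1)" by simp
    ultimately show "ereal B \<le> Sup (ereal ` {q<..})" by (rule order_trans[rotated])
  qed
  ultimately show ?thesis
    using assms unfolding mtl_interval_def inf_endpoint_def sup_endpoint_def
    by (auto simp: is_interval_1 intro: exI[of _ "q + 1"])
qed

text \<open>Non-emptiness makes the infimum \<open>q\<close> finite, hence rational. Points of
  \<open>I\<close> arbitrarily close to \<open>q\<close> and arbitrarily large ones fill the open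
  ray by convexity, so only membership of \<open>q\<close> is left open; if \<open>q\<close> belongs
  to \<open>I\<close> it is positive.\<close>

lemma unbounded_mtl_interval_cases:
  assumes "mtl_interval I" "\<not> bounded I"
  obtains q where "q \<in> \<rat>" "q \<ge> 0" "I = {q<..}" | q where "q \<in> \<rat>" "q > 0" "I = {q..}"
proof -
  have ne: "I \<noteq> {}" and pos: "I \<subseteq> {0<..}" and int: "is_interval I"
    using assms(1) unfolding mtl_interval_def by auto
  obtain t0 where "t0 \<in> I" using ne by blast
  then have "inf_endpoint I \<le> ereal t0" unfolding inf_endpoint_def by (intro Inf_lower) auto
  then have "inf_endpoint I \<noteq> \<infinity>" by auto
  then obtain q where q: "q \<in> \<rat>" "Inf (ereal ` I) = ereal q"
    using assms(1) unfolding mtl_interval_def inf_endpoint_def by auto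
  have lower: "q \<le> t" if "t \<in> I" for t
  proof -
    have "Inf (ereal ` I) \<le> ereal t" using that by (intro Inf_lower) auto
    then show ?thesis using q by simp
  qed
  have "ereal 0 \<le> Inf (ereal ` I)" using pos by (intro Inf_greatest) auto
  then have q0: "q \<ge> 0" using q by simp
  have gt: "{q<..} \<subseteq> I"
  proof
    fix z assume "z \<in> {q<..}"
    then have "Inf (ereal ` I) < ereal z" using q by simp
    then obtain s where s: "s \<in> I" "s < z" unfolding Inf_less_iff by auto
    obtain t where t: "t \<in> I" "z < t"
    proof (rule ccontr)
      assume "\<not> thesis"
      then have "\<forall>t\<in>I. t \<le> z" using that by force
      then have "I \<subseteq> {0..z}" using pos by force
      then show False using assms(2) bounded_subset bounded_closed_interval by blast
    qed
    show "z \<in> I" using int s t unfolding is_interval_1 by (meson less_imp_le)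
  qed
  show ?thesis
  proof (cases "q \<in> I")
    case True
    then have "I = {q..}" using gt lower by (auto simp: order_le_less)
    then show ?thesis using that(2) q True pos by auto
  next
    case False
    then have "I = {q<..}" using gt lower by (force simp: order_le_less)
    then show ?thesis using that(1) q q0 by auto
  qed
qed

section \<open>Bounded formulas\<close>

definition bounded_sem :: "'p set \<Rightarrow> 'p sem set" where
  "bounded_sem P = (\<lambda>\<phi> f r. sat f r \<phi>) ` {\<phi> \<in> mtl P. bounded_intervals \<phi>}"

lemma sat_Until_iff: "sat f r (Until \<phi> I \<psi>) \<longleftrightarrow> until_in I (\<lambda>u. sat f u \<phi>) (\<lambda>u. sat f u \<psi>) r"
  unfolding until_in_def by simp

lemma sat_Since_iff: "sat f r (Since \<phi> I \<psi>) \<longleftrightarrow> since_in I (\<lambda>u. sat f u \<phi>) (\<lambda>u. sat f u \<psi>) r"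
  unfolding since_in_def by simp

lemma bounded_semI:
  "\<phi> \<in> mtl P \<Longrightarrow> bounded_intervals \<phi> \<Longrightarrow> (\<And>f r. p f r \<longleftrightarrow> sat f r \<phi>) \<Longrightarrow> p \<in> bounded_sem P"
  unfolding bounded_sem_def by (intro image_eqI[of _ _ \<phi>]) auto

lemma bounded_semE:
  assumes "p \<in> bounded_sem P"
  obtains \<phi> where "\<phi> \<in> mtl P" "bounded_intervals \<phi>" "p = (\<lambda>f r. sat f r \<phi>)"
  using assms unfolding bounded_sem_def by blast

interpretation bounded_sem: bool_closed "bounded_sem P" for P
proof
  show "(\<lambda>f r. True) \<in> bounded_sem P" by (rule bounded_semI[of TT]) (auto intro: mtl.TT)
next
  fix p assume "p \<in> bounded_sem P"
  then obtain \<phi> where "\<phi> \<in> mtl P" "bounded_intervals \<phi>" "p = (\<lambda>f r. sat f r \<phi>)" by (rule bounded_semE)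
  then show "(\<lambda>f r. \<not> p f r) \<in> bounded_sem P" by (intro bounded_semI[of "Neg \<phi>"]) (auto intro: mtl.Neg)
next
  fix p q assume p: "p \<in> bounded_sem P" and q: "q \<in> bounded_sem P"
  obtain \<phi> where "\<phi> \<in> mtl P" "bounded_intervals \<phi>" "p = (\<lambda>f r. sat f r \<phi>)"
    using p by (rule bounded_semE)
  moreover obtain \<psi> where "\<psi> \<in> mtl P" "bounded_intervals \<psi>" "q = (\<lambda>f r. sat f r \<psi>)"
    using q by (rule bounded_semE)
  ultimately show "(\<lambda>f r. p f r \<and> q f r) \<in> bounded_sem P"
    by (intro bounded_semI[of "And \<phi> \<psi>"]) (auto intro: mtl.And)
qed

lemma bounded_sem_until_in:
  assumes p: "p \<in> bounded_sem P" and q: "q \<in> bounded_sem P" and I: "mtl_interval I" "bounded I"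
  shows "(\<lambda>f r. until_in I (p f) (q f) r) \<in> bounded_sem P"
proof -
  obtain \<phi> where "\<phi> \<in> mtl P" "bounded_intervals \<phi>" "p = (\<lambda>f r. sat f r \<phi>)"
    using p by (rule bounded_semE)
  moreover obtain \<psi> where "\<psi> \<in> mtl P" "bounded_intervals \<psi>" "q = (\<lambda>f r. sat f r \<psi>)"
    using q by (rule bounded_semE)
  ultimately show ?thesis
    using I by (intro bounded_semI[of "Until \<phi> I \<psi>"]) (auto intro: mtl.Until simp: sat_Until_iff simp del: sat.simps)
qed

lemma bounded_sem_since_in:
  assumes p: "p \<in> bounded_sem P" and q: "q \<in> bounded_sem P" and I: "mtl_interval I" "bounded I"
  shows "(\<lambda>f r. since_in I (p f) (q f) r) \<in> bounded_sem P"
proof -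
  obtain \<phi> where "\<phi> \<in> mtl P" "bounded_intervals \<phi>" "p = (\<lambda>f r. sat f r \<phi>)"
    using p by (rule bounded_semE)
  moreover obtain \<psi> where "\<psi> \<in> mtl P" "bounded_intervals \<psi>" "q = (\<lambda>f r. sat f r \<psi>)"
    using q by (rule bounded_semE)
  ultimately show ?thesis
    using I by (intro bounded_semI[of "Since \<phi> I \<psi>"]) (auto intro: mtl.Since simp: sat_Since_iff simp del: sat.simps)
qed

lemma until_in_singleton: "0 < q \<Longrightarrow> until_in {q} (\<lambda>_. True) b r \<longleftrightarrow> b (r + q)"
  unfolding until_in_def by (auto intro!: exI[of _ "r + q"] simp: algebra_simps)

lemma since_in_singleton: "0 < q \<Longrightarrow> since_in {q} (\<lambda>_. True) b r \<longleftrightarrow> b (r - q)"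
  unfolding since_in_def by (auto intro!: exI[of _ "r - q"] simp: algebra_simps)

text \<open>A shift by a non-zero rational is the diamond over a singleton interval, in the future
  or in the past according to its sign. Rationality makes the singleton admissible.\<close>

lemma bounded_sem_shift:
  assumes "p \<in> bounded_sem P" "q \<in> \<rat>"
  shows "(\<lambda>f r. p f (r + q)) \<in> bounded_sem P"
proof (cases q "0 :: real" rule: linorder_cases)
  case less
  then show ?thesis
    using bounded_sem_since_in[OF bounded_sem.tt assms(1), of "{- q}"] mtl_interval_singleton[of "- q"] assms(2)
    by (simp add: since_in_singleton)
next
  case greater
  then show ?thesis
    using bounded_sem_until_in[OF bounded_sem.tt assms(1), of "{q}"] mtl_interval_singleton[of q] assms(2)
    by (simp add: until_in_singleton)
qed (use assms in simp)

text \<open>The syntactic counterpart of \<open>reversal\<close>. It swaps future-reach with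
  past-reach and hence the first two kinds of formulas in the theorem.\<close>

primrec mirror :: "'p fm \<Rightarrow> 'p fm" where
  "mirror TT = TT"
| "mirror (Atom p) = Atom p"
| "mirror (And \<phi> \<psi>) = And (mirror \<phi>) (mirror \<psi>)"
| "mirror (Neg \<phi>) = Neg (mirror \<phi>)"
| "mirror (Until \<phi> I \<psi>) = Since (mirror \<phi>) I (mirror \<psi>)"
| "mirror (Since \<phi> I \<psi>) = Until (mirror \<phi>) I (mirror \<psi>)"

lemma mirror_mtl: "\<phi> \<in> mtl P \<Longrightarrow> mirror \<phi> \<in> mtl P"
  by (induction rule: mtl.induct) (auto intro: mtl.intros)

lemma bounded_intervals_mirror [simp]: "bounded_intervals (mirror \<phi>) \<longleftrightarrow> bounded_intervals \<phi>"
  by (induction \<phi>) auto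

lemma fr_mirror [simp]: "fr (mirror \<phi>) = pr \<phi>" and pr_mirror [simp]: "pr (mirror \<phi>) = fr \<phi>"
  by (induction \<phi>) auto

lemma sem_mirror: "(\<lambda>f r. sat f r (mirror \<phi>)) = reversal (\<lambda>f r. sat f r \<phi>)"
proof (induction \<phi>)
  case (Until \<phi> I \<psi>)
  then show ?case
    unfolding mirror.simps sat_Until_iff sat_Since_iff reversal_until_in by (simp add: fun_eq_iff)
next
  case (Since \<phi> I \<psi>)
  then show ?case
    unfolding mirror.simps sat_Until_iff sat_Since_iff reversal_since_in by (simp add: fun_eq_iff)
qed (auto simp: reversal_def fun_eq_iff)

lemma reversal_bounded_sem_mem: "p \<in> bounded_sem P \<Longrightarrow> reversal p \<in> bounded_sem P"
proof (erule bounded_semE)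
  fix \<phi> assume "\<phi> \<in> mtl P" "bounded_intervals \<phi>" "p = (\<lambda>f r. sat f r \<phi>)"
  then show "reversal p \<in> bounded_sem P"
    unfolding sem_mirror[symmetric] \<open>p = _\<close> by (intro bounded_semI[of "mirror \<phi>"] mirror_mtl) auto
qed

lemma reversal_bounded_sem [simp]: "reversal ` bounded_sem P = bounded_sem P"
  using reversal_bounded_sem_mem by (auto simp: in_reversal_image_iff)

section \<open>Windows\<close>

text \<open>
  \<open>p \<in> windowed P D L\<close>: finitely many predicates \<open>X\<close> of \<open>D\<close> decide at \<open>r\<close> which bounded
  formula \<open>\<beta>\<close> represents \<open>p\<close> on all of \<open>[r - L, r + L]\<close>.
\<close>

definition windowed :: "'p set \<Rightarrow> 'p sem set \<Rightarrow> real \<Rightarrow> 'p sem set" where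
  "windowed P D L = {p. \<exists>S. S \<subseteq> D \<times> bounded_sem P \<and> finite S \<and> (\<forall>f r. \<exists>(X, \<beta>)\<in>S. X f r) \<and>
     (\<forall>(X, \<beta>)\<in>S. \<forall>f r. X f r \<longrightarrow> (\<forall>u. \<bar>u - r\<bar> \<le> L \<longrightarrow> p f u = \<beta> f u))}"

lemma windowedI:
  assumes "finite S" "\<And>X \<beta>. (X, \<beta>) \<in> S \<Longrightarrow> X \<in> D" "\<And>X \<beta>. (X, \<beta>) \<in> S \<Longrightarrow> \<beta> \<in> bounded_sem P"
    "\<And>f r. \<exists>X \<beta>. (X, \<beta>) \<in> S \<and> X f r"
    "\<And>X \<beta> f r u. (X, \<beta>) \<in> S \<Longrightarrow> X f r \<Longrightarrow> \<bar>u - r\<bar> \<le> L \<Longrightarrow> p f u = \<beta> f u"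
  shows "p \<in> windowed P D L"
proof -
  have "S \<subseteq> D \<times> bounded_sem P" using assms(2,3) by (simp add: subset_iff)
  moreover have "\<forall>f r. \<exists>(X, \<beta>)\<in>S. X f r" using assms(4) by (simp add: Bex_def)
  moreover have "\<forall>(X, \<beta>)\<in>S. \<forall>f r. X f r \<longrightarrow> (\<forall>u. \<bar>u - r\<bar> \<le> L \<longrightarrow> p f u = \<beta> f u)"
    using assms(5) by (simp add: Ball_def)
  ultimately show ?thesis unfolding windowed_def using assms(1) by simp (intro exI[of _ S] conjI; assumption)
qed

lemma windowedE:
  assumes "p \<in> windowed P D L"
  obtains S where "finite S" "\<And>X \<beta>. (X, \<beta>) \<in> S \<Longrightarrow> X \<in> D" "\<And>X \<beta>. (X, \<beta>) \<in> S \<Longrightarrow> \<beta> \<in> bounded_sem P"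
    "\<And>f r. \<exists>X \<beta>. (X, \<beta>) \<in> S \<and> X f r"
    "\<And>X \<beta> f r u. (X, \<beta>) \<in> S \<Longrightarrow> X f r \<Longrightarrow> \<bar>u - r\<bar> \<le> L \<Longrightarrow> p f u = \<beta> f u"
proof -
  obtain S where S: "S \<subseteq> D \<times> bounded_sem P" "finite S" "\<forall>f r. \<exists>(X, \<beta>)\<in>S. X f r"
    "\<forall>(X, \<beta>)\<in>S. \<forall>f r. X f r \<longrightarrow> (\<forall>u. \<bar>u - r\<bar> \<le> L \<longrightarrow> p f u = \<beta> f u)"
    using assms unfolding windowed_def by blast
  show ?thesis
  proof (rule that[OF S(2)])
    show "\<exists>X \<beta>. (X, \<beta>) \<in> S \<and> X f r" for f r using S(3) by (simp add: Bex_def)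
    show "p f u = \<beta> f u" if "(X, \<beta>) \<in> S" "X f r" "\<bar>u - r\<bar> \<le> L" for X \<beta> f r u
      using S(4) that by (simp add: Ball_def)
  qed (use S(1) in auto)
qed

lemma windowed_mono: "D \<subseteq> D' \<Longrightarrow> windowed P D L \<subseteq> windowed P D' L"
proof (intro subsetI, erule windowedE)
  fix p S
  assume D: "D \<subseteq> D'" and S: "finite S" "\<And>X \<beta>. (X, \<beta>) \<in> S \<Longrightarrow> X \<in> D"
    "\<And>X \<beta>. (X, \<beta>) \<in> S \<Longrightarrow> \<beta> \<in> bounded_sem P" "\<And>f r. \<exists>X \<beta>. (X, \<beta>) \<in> S \<and> X f r"
    "\<And>X \<beta> f r u. (X, \<beta>) \<in> S \<Longrightarrow> X f r \<Longrightarrow> \<bar>u - r\<bar> \<le> L \<Longrightarrow> p f u = \<beta> f u"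
  show "p \<in> windowed P D' L"
  proof (rule windowedI[where S = S])
    show "X \<in> D'" if "(X, \<beta>) \<in> S" for X \<beta> using D S(2)[OF that] by blast
    show "p f u = \<beta> f u" if "(X, \<beta>) \<in> S" "X f r" "\<bar>u - r\<bar> \<le> L" for X \<beta> f r u
      using that by (rule S(5))
  qed (rule S; assumption)+
qed

section \<open>Operations on windowed predicates\<close>

context bool_closed
begin

lemma windowed_bounded_sem: "p \<in> bounded_sem P \<Longrightarrow> p \<in> windowed P C L"
  by (rule windowedI[of "{(\<lambda>f r. True, p)}"]) (auto intro: tt)

lemma finite_disj: "finite A \<Longrightarrow> (\<And>a. a \<in> A \<Longrightarrow> X a \<in> C) \<Longrightarrow> (\<lambda>f r. \<exists>a\<in>A. X a f r) \<in> C"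
proof (induction rule: finite_induct)
  case empty
  then show ?case using neg[OF tt] by simp
next
  case (insert a A)
  then show ?case using disj[of "X a" "\<lambda>f r. \<exists>a\<in>A. X a f r"] by simp
qed

text \<open>Reading the representation at the centre of the window, \<open>u = r\<close>, expresses
  \<open>p\<close> as a finite disjunction of conjunctions of a case with its bounded
  formula.\<close>

lemma windowed_subset:
  assumes "p \<in> windowed P C L" "0 \<le> L" "bounded_sem P \<subseteq> C"
  shows "p \<in> C"
  using assms(1)
proof (cases rule: windowedE)
  case (1 S)
  have "p = (\<lambda>f r. \<exists>a\<in>S. fst a f r \<and> snd a f r)"
  proof (intro ext)
    fix f r
    have eq: "p f r = \<beta> f r" if "(X, \<beta>) \<in> S" "X f r" for X \<beta>
      using 1(5)[OF that, of r] assms(2) by simp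
    show "p f r = (\<exists>a\<in>S. fst a f r \<and> snd a f r)"
    proof
      assume "p f r"
      moreover obtain X \<beta> where X: "(X, \<beta>) \<in> S" "X f r" using 1(4)[of f r] by blast
      ultimately show "\<exists>a\<in>S. fst a f r \<and> snd a f r" using eq[OF X] by (intro bexI[OF _ X(1)]) simp
    next
      assume "\<exists>a\<in>S. fst a f r \<and> snd a f r"
      then obtain X \<beta> where X: "(X, \<beta>) \<in> S" "X f r" "\<beta> f r" by auto
      then show "p f r" using eq[OF X(1,2)] by simp
    qed
  qed
  also have "\<dots> \<in> C"
  proof (intro finite_disj conj 1(1))
    show "fst a \<in> C" "snd a \<in> C" if "a \<in> S" for a
      using 1(2,3)[of "fst a" "snd a"] that assms(3) by auto
  qed
  finally show ?thesis .
qed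

text \<open>The hypothesis \<open>local\<close> says that on the window of radius \<open>L\<close>
  the operator sees its arguments only within radius \<open>L'\<close>. Pairing each case for
  \<open>p\<close> with each case for \<open>q\<close> then fixes both arguments as bounded
  formulas, to which the operator is applied.\<close>

lemma windowed_op:
  assumes F: "\<And>p q. p \<in> bounded_sem P \<Longrightarrow> q \<in> bounded_sem P \<Longrightarrow> (\<lambda>f r. F (p f) (q f) r) \<in> bounded_sem P"
    and local: "\<And>a a' b b' r u. (\<And>v. \<bar>v - r\<bar> \<le> L' \<Longrightarrow> a v = a' v) \<Longrightarrow>
      (\<And>v. \<bar>v - r\<bar> \<le> L' \<Longrightarrow> b v = b' v) \<Longrightarrow> \<bar>u - r\<bar> \<le> L \<Longrightarrow> F a b u = F a' b' u"
    and p: "p \<in> windowed P C L'" and q: "q \<in> windowed P C L'"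
  shows "(\<lambda>f r. F (p f) (q f) r) \<in> windowed P C L"
  using p
proof (cases rule: windowedE)
  case S: (1 S)
  from q show ?thesis
  proof (cases rule: windowedE)
    case T: (1 T)
  define G where "G = (\<lambda>((X, \<alpha>), (Y, \<beta>)). ((\<lambda>f r. X f r \<and> Y f r), (\<lambda>f r. F (\<alpha> f) (\<beta> f) r))) ` (S \<times> T)"
  have G: "(Z, \<gamma>) \<in> G \<longleftrightarrow> (\<exists>X \<alpha> Y \<beta>. (X, \<alpha>) \<in> S \<and> (Y, \<beta>) \<in> T \<and> Z = (\<lambda>f r. X f r \<and> Y f r) \<and>
    \<gamma> = (\<lambda>f r. F (\<alpha> f) (\<beta> f) r))" for Z \<gamma>
    unfolding G_def by force
  show ?thesis
  proof (rule windowedI[of G])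
    show "finite G" unfolding G_def using S(1) T(1) by blast
    show "Z \<in> C" if "(Z, \<gamma>) \<in> G" for Z \<gamma> using that S(2) T(2) unfolding G by (auto intro: conj)
    show "\<gamma> \<in> bounded_sem P" if "(Z, \<gamma>) \<in> G" for Z \<gamma> using that S(3) T(3) unfolding G by (auto intro: F)
    show "\<exists>Z \<gamma>. (Z, \<gamma>) \<in> G \<and> Z f r" for f r
    proof -
      obtain X \<alpha> Y \<beta> where "(X, \<alpha>) \<in> S" "X f r" "(Y, \<beta>) \<in> T" "Y f r" using S(4)[of f r] T(4)[of f r] by blast
      then show ?thesis unfolding G
        by (intro exI[of _ "\<lambda>f r. X f r \<and> Y f r"] exI[of _ "\<lambda>f r. F (\<alpha> f) (\<beta> f) r"]) blast
    qed
    show "F (p f) (q f) u = \<gamma> f u" if g: "(Z, \<gamma>) \<in> G" "Z f r" "\<bar>u - r\<bar> \<le> L" for Z \<gamma> f r u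
    proof -
      obtain X \<alpha> Y \<beta> where X: "(X, \<alpha>) \<in> S" "X f r" "(Y, \<beta>) \<in> T" "Y f r" "\<gamma> = (\<lambda>f r. F (\<alpha> f) (\<beta> f) r)"
        using g(1,2) unfolding G by auto
      have "F (p f) (q f) u = F (\<alpha> f) (\<beta> f) u"
        using S(5)[OF X(1,2)] T(5)[OF X(3,4)] g(3) by (intro local[of r])
      then show ?thesis unfolding X(5) .
    qed
  qed
  qed
qed

text \<open>The single predicate \<open>X\<close>, evaluated at the centre, selects for the whole
  window whether \<open>p\<close> or \<open>q\<close> stands in for \<open>s\<close>, so the two
  families of cases are refined by \<open>X\<close> and its negation.\<close>

lemma windowed_cases:
  assumes X: "X \<in> C" and p: "p \<in> windowed P C L" and q: "q \<in> windowed P C L"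
    and eqp: "\<And>f r u. X f r \<Longrightarrow> \<bar>u - r\<bar> \<le> L \<Longrightarrow> s f u = p f u"
    and eqq: "\<And>f r u. \<not> X f r \<Longrightarrow> \<bar>u - r\<bar> \<le> L \<Longrightarrow> s f u = q f u"
  shows "s \<in> windowed P C L"
  using p
proof (cases rule: windowedE)
  case S: (1 S)
  from q show ?thesis
  proof (cases rule: windowedE)
    case T: (1 T)
  define G where "G = (\<lambda>(Y, \<beta>). ((\<lambda>f r. X f r \<and> Y f r), \<beta>)) ` S \<union> (\<lambda>(Y, \<beta>). ((\<lambda>f r. \<not> X f r \<and> Y f r), \<beta>)) ` T"
  have G: "(Z, \<beta>) \<in> G \<longleftrightarrow> (\<exists>Y. (Y, \<beta>) \<in> S \<and> Z = (\<lambda>f r. X f r \<and> Y f r)) \<or>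
    (\<exists>Y. (Y, \<beta>) \<in> T \<and> Z = (\<lambda>f r. \<not> X f r \<and> Y f r))" for Z \<beta>
    unfolding G_def by force
  show ?thesis
  proof (rule windowedI[of G])
    show "finite G" unfolding G_def using S(1) T(1) by blast
    show "Z \<in> C" if "(Z, \<gamma>) \<in> G" for Z \<gamma> using that S(2) T(2) X unfolding G by (auto intro: conj neg)
    show "\<gamma> \<in> bounded_sem P" if "(Z, \<gamma>) \<in> G" for Z \<gamma> using that S(3) T(3) unfolding G by auto
    show "\<exists>Z \<gamma>. (Z, \<gamma>) \<in> G \<and> Z f r" for f r
    proof (cases "X f r")
      case True
      obtain Y \<beta> where "(Y, \<beta>) \<in> S" "Y f r" using S(4)[of f r] by blast
      then show ?thesis using True unfolding G by (intro exI[of _ "\<lambda>f r. X f r \<and> Y f r"] exI[of _ \<beta>]) blast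
    next
      case False
      obtain Y \<beta> where "(Y, \<beta>) \<in> T" "Y f r" using T(4)[of f r] by blast
      then show ?thesis using False unfolding G by (intro exI[of _ "\<lambda>f r. \<not> X f r \<and> Y f r"] exI[of _ \<beta>]) blast
    qed
    show "s f u = \<gamma> f u" if "(Z, \<gamma>) \<in> G" "Z f r" "\<bar>u - r\<bar> \<le> L" for Z \<gamma> f r u
      using that(1) unfolding G
    proof (elim disjE exE conjE)
      fix Y assume "(Y, \<gamma>) \<in> S" "Z = (\<lambda>f r. X f r \<and> Y f r)"
      then show ?thesis using S(5)[of Y \<gamma> f r u] eqp[of f r u] that by simp
    next
      fix Y assume "(Y, \<gamma>) \<in> T" "Z = (\<lambda>f r. \<not> X f r \<and> Y f r)"
      then show ?thesis using T(5)[of Y \<gamma> f r u] eqq[of f r u] that by simp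
    qed
  qed
  qed
qed

end

lemma bounded_mtl_interval:
  assumes "bounded I" "mtl_interval I"
  obtains K where "K > 0" "I \<subseteq> {0<..K}"
proof -
  obtain a where "\<forall>x\<in>I. norm x \<le> a" using assms(1) bounded_iff by blast
  then have "I \<subseteq> {0<..max a 1}" using assms(2) unfolding mtl_interval_def by fastforce
  then show ?thesis using that[of "max a 1"] by simp
qed

lemma until_in_cong:
  assumes "\<And>v. r < v \<Longrightarrow> v \<le> r + K \<Longrightarrow> a v = a' v" "\<And>v. r < v \<Longrightarrow> v \<le> r + K \<Longrightarrow> b v = b' v" "I \<subseteq> {0<..K}"
  shows "until_in I a b r \<longleftrightarrow> until_in I a' b' r"
proof -
  have "t \<le> r + K" if "t - r \<in> I" for t using assms(3) that by force
  then have "t - r \<in> I \<and> b t \<and> (\<forall>u. r < u \<and> u < t \<longrightarrow> a u) \<longleftrightarrow>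
    t - r \<in> I \<and> b' t \<and> (\<forall>u. r < u \<and> u < t \<longrightarrow> a' u)" if "r < t" for t
    using assms(1,2) that by (metis less_imp_le order_less_le_trans)
  then show ?thesis unfolding until_in_def by blast
qed

section \<open>Predicates representable by bounded formulas on every window\<close>

locale extends_bounded = bool_closed D for D :: "'p sem set" +
  fixes P :: "'p set"
  assumes bounded_sem_subset: "bounded_sem P \<subseteq> D"
begin

text \<open>A bounded operator on a window of radius \<open>L\<close> consults its arguments on a
  larger window. Intersecting over all radii absorbs this loss and makes the class closed under such
  operators.\<close>

definition W :: "'p sem set" where
  "W = (\<Inter>L. windowed P D L)"

lemma W_I: "(\<And>L. p \<in> windowed P D L) \<Longrightarrow> p \<in> W"
  unfolding W_def by blast

lemma W_windowed: "p \<in> W \<Longrightarrow> p \<in> windowed P D L"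
  unfolding W_def by blast

lemma bounded_sem_W: "p \<in> bounded_sem P \<Longrightarrow> p \<in> W"
  by (intro W_I windowed_bounded_sem)

lemma W_subset: "p \<in> W \<Longrightarrow> p \<in> D"
  using windowed_subset[OF W_windowed[of p 0] _ bounded_sem_subset] by simp

sublocale W: bool_closed W
proof
  show "(\<lambda>f r. True) \<in> W" by (intro bounded_sem_W bounded_sem.tt)
next
  fix p assume "p \<in> W"
  then show "(\<lambda>f r. \<not> p f r) \<in> W"
    by (intro W_I windowed_op[where p = p and q = p and F = "\<lambda>a b u. \<not> a u"]) (auto intro: bounded_sem.neg W_windowed)
next
  fix p q assume "p \<in> W" "q \<in> W"
  then show "(\<lambda>f r. p f r \<and> q f r) \<in> W"
    by (intro W_I windowed_op[where p = p and q = q and F = "\<lambda>a b u. a u \<and> b u"])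
      (auto intro: bounded_sem.conj W_windowed)
qed

lemma W_until_in:
  assumes "p \<in> W" "q \<in> W" "mtl_interval I" "bounded I"
  shows "(\<lambda>f r. until_in I (p f) (q f) r) \<in> W"
proof (rule W_I)
  fix L
  obtain K where K: "K > 0" "I \<subseteq> {0<..K}" using assms(3,4) bounded_mtl_interval by blast
  show "(\<lambda>f r. until_in I (p f) (q f) r) \<in> windowed P D L"
    by (rule windowed_op[where L' = "\<bar>L\<bar> + K", OF bounded_sem_until_in[OF _ _ assms(3,4)]
        until_in_cong[OF _ _ K(2)] W_windowed W_windowed]) (use assms K(1) in auto)
qed

text \<open>For \<open>u\<close> in the window, the until at \<open>u\<close> holds iff it is
  realised within distance \<open>K\<close>, or \<open>p\<close> persists through that distance and
  the until holds at \<open>r + M\<close>. The last condition depends on \<open>r\<close> alone, so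
  it is the bit that selects the case.\<close>

lemma W_until:
  assumes p: "p \<in> W" and q: "q \<in> W" and shift: "\<And>L. \<exists>M>L. (\<lambda>f r. until (p f) (q f) (r + M)) \<in> D"
  shows "(\<lambda>f r. until (p f) (q f) r) \<in> W"
proof (rule W_I)
  fix L
  obtain M where M: "M > \<bar>L\<bar>" "(\<lambda>f r. until (p f) (q f) (r + M)) \<in> D" using shift by blast
  \<comment> \<open>With \<open>M\<close> above the radius and \<open>K\<close> above
    \<open>\<bar>L\<bar> + M\<close>, the checkpoint \<open>r + M\<close> lies strictly between
    \<open>u\<close> and \<open>u + K\<close> for every \<open>u\<close> in the window. An integer
    \<open>K\<close> gives a rational endpoint.\<close>
  obtain K :: nat where K: "real K > \<bar>L\<bar> + M" using reals_Archimedean2 by blast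
  then have I: "mtl_interval {0<..real K}" using M by (intro mtl_interval_Ioc) auto
  let ?A = "\<lambda>f r. until_in {0<..real K} (p f) (q f) r"
  let ?B = "\<lambda>f r. \<not> until_in {0<..real K} (\<lambda>_. True) (\<lambda>u. \<not> p f u) r"
  have A: "?A \<in> W" and AB: "(\<lambda>f r. ?A f r \<or> ?B f r) \<in> W"
    by (intro W_until_in W.bool_intros W.tt p q I bounded_Ioc)+
  have B: "?B f u \<longleftrightarrow> (\<forall>v. u < v \<and> v \<le> u + K \<longrightarrow> p f v)" for f u
    unfolding until_in_def by force
  have AU: "until (p f) (q f) u" if "?A f u" for f u
    using that unfolding until_in_def until_def by blast
  have UA: "?A f u \<or> ?B f u \<and> until (p f) (q f) (r + M)"
    if U: "until (p f) (q f) u" and "\<bar>u - r\<bar> \<le> L" for f r u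
  proof -
    obtain t where t: "u < t" "q f t" "\<forall>v. u < v \<and> v < t \<longrightarrow> p f v" using U unfolding until_def by blast
    show ?thesis
    proof (cases "t \<le> u + K")
      case True
      then show ?thesis using t unfolding until_in_def by force
    next
      case False
      moreover have "u < r + M" "r + M < u + K" using that(2) M K by auto
      ultimately have "until (p f) (q f) (r + M)" using t unfolding until_def by (intro exI[of _ t]) auto
      then show ?thesis using False t B by auto
    qed
  qed
  have BU: "until (p f) (q f) u" if BU: "?B f u" "until (p f) (q f) (r + M)" and "\<bar>u - r\<bar> \<le> L" for f r u
  proof -
    obtain t where t: "r + M < t" "q f t" "\<forall>v. r + M < v \<and> v < t \<longrightarrow> p f v"
      using BU unfolding until_def by blast
    have "u < r + M" "r + M < u + K" using that(3) M K by auto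
    moreover have "p f v" if "u < v" "v < t" for v
      using t(3) that BU(1) \<open>r + M < u + K\<close> unfolding B by (cases "v \<le> r + M") auto
    ultimately show ?thesis using t unfolding until_def by (intro exI[of _ t]) auto
  qed
  show "(\<lambda>f r. until (p f) (q f) r) \<in> windowed P D L"
    \<comment> \<open>If the bit is true, the until agrees on the window with the disjunction of
      \<open>?A\<close> and \<open>?B\<close>; if it is false, it agrees with
      \<open>?A\<close>.\<close>
    by (rule windowed_cases[OF M(2) W_windowed[OF AB] W_windowed[OF A]]) (use AU UA BU in blast)+
qed

end

section \<open>Separation\<close>

text \<open>Level \<open>n\<close> allows unbounded untils nested at most \<open>n\<close> deep over
  bounded formulas. The bounded formulas may contain since, so these are future formulas up to a
  bounded look into the past.\<close>

primrec fut :: "'p set \<Rightarrow> nat \<Rightarrow> 'p sem set" where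
  "fut P 0 = bounded_sem P"
| "fut P (Suc n) = bool_closure (fut P n \<union> {\<lambda>f r. until (x f) (y f) r | x y. x \<in> fut P n \<and> y \<in> fut P n})"

lemma fut_until: "x \<in> fut P n \<Longrightarrow> y \<in> fut P n \<Longrightarrow> (\<lambda>f r. until (x f) (y f) r) \<in> fut P (Suc n)"
  by (auto intro: bool_closure.base)

lemma fut_mono: "m \<le> n \<Longrightarrow> fut P m \<subseteq> fut P n"
  by (rule lift_Suc_mono_le) (auto intro: bool_closure.base)

interpretation fut: extends_bounded "fut P n" P for P n
proof (intro extends_bounded.intro extends_bounded_axioms.intro)
  show "bool_closed (fut P n)"
    by (cases n) (auto intro: bool_closure.bool_closed_axioms bounded_sem.bool_closed_axioms)
  show "bounded_sem P \<subseteq> fut P n" using fut_mono[of 0 n P] by simp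
qed

section \<open>Shifts and windows of future formulas\<close>

lemma until_shift: "until a b (r + q) \<longleftrightarrow> until (\<lambda>u. a (u + q)) (\<lambda>u. b (u + q)) r"
proof
  assume "until a b (r + q)"
  then obtain t where t: "t > r + q" "b t" "\<forall>u. r + q < u \<and> u < t \<longrightarrow> a u" unfolding until_def by blast
  then show "until (\<lambda>u. a (u + q)) (\<lambda>u. b (u + q)) r"
    unfolding until_def by (intro exI[of _ "t - q"]) auto
next
  assume "until (\<lambda>u. a (u + q)) (\<lambda>u. b (u + q)) r"
  then obtain t where t: "t > r" "b (t + q)" "\<forall>u. r < u \<and> u < t \<longrightarrow> a (u + q)" unfolding until_def by blast
  have "a u" if "r + q < u" "u < t + q" for u using t(3)[rule_format, of "u - q"] that by simp
  then show "until a b (r + q)" using t unfolding until_def by (intro exI[of _ "t + q"]) auto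
qed

lemma fut_shift:
  assumes "q \<in> \<rat>"
  shows "p \<in> fut P n \<Longrightarrow> (\<lambda>f r. p f (r + q)) \<in> fut P n"
proof (induction n arbitrary: p)
  case 0
  then show ?case using assms by (simp add: bounded_sem_shift)
next
  case (Suc n)
  show ?case
  proof (rule bool_closure_image[where g = "\<lambda>f. f" and h = "\<lambda>r. r + q"])
    show "p \<in> bool_closure (fut P n \<union> {\<lambda>f r. until (x f) (y f) r | x y. x \<in> fut P n \<and> y \<in> fut P n})"
      using Suc.prems by simp
    fix s assume "s \<in> fut P n \<union> {\<lambda>f r. until (x f) (y f) r | x y. x \<in> fut P n \<and> y \<in> fut P n}"
    then consider "s \<in> fut P n" | x y where "x \<in> fut P n" "y \<in> fut P n" "s = (\<lambda>f r. until (x f) (y f) r)"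
      by blast
    then show "(\<lambda>f r. s f (r + q)) \<in> fut P (Suc n)"
    proof cases
      case 1
      then show ?thesis using Suc.IH fut_mono[of n "Suc n" P] by auto
    next
      case 2
      then show ?thesis unfolding 2(3) until_shift by (intro fut_until Suc.IH)
    qed
  qed (rule fut.bool_closed_axioms)
qed

lemma W_mono:
  assumes "extends_bounded D P" "extends_bounded D' P" "D \<subseteq> D'"
  shows "extends_bounded.W D P \<subseteq> extends_bounded.W D' P"
  unfolding extends_bounded.W_def[OF assms(1)] extends_bounded.W_def[OF assms(2)]
  by (intro INF_mono') (rule windowed_mono[OF assms(3)])

text \<open>Induction on the level through \<open>W_until\<close>. The class \<open>C\<close> is
  asked only for arbitrarily late shifts of each until, which is what formulas of the form
  \<open>Dia {N}\<close> with large \<open>N\<close> offer; the result is applied to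
  \<open>fut P n\<close> and to \<open>generated P\<close>.\<close>

lemma fut_subset_W:
  assumes C: "extends_bounded C P"
    and shift: "\<And>x y m L. m < n \<Longrightarrow> x \<in> fut P m \<Longrightarrow> y \<in> fut P m \<Longrightarrow> \<exists>M>L. (\<lambda>f r. until (x f) (y f) (r + M)) \<in> C"
  shows "fut P n \<subseteq> extends_bounded.W C P"
  using shift
proof (induction n)
  case 0
  then show ?case using extends_bounded.bounded_sem_W[OF C] by auto
next
  case (Suc n)
  interpret extends_bounded C P by fact
  have IH: "fut P n \<subseteq> W" 
  proof (rule Suc.IH)
    fix m x y and L :: real assume "m < n" "x \<in> fut P m" "y \<in> fut P m"
    then show "\<exists>M>L. (\<lambda>f r. until (x f) (y f) (r + M)) \<in> C" by (intro Suc.prems[of m]) auto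
  qed
  show ?case unfolding fut.simps
  proof (intro bool_closure_least W.bool_closed_axioms Un_least IH subsetI)
    fix p assume "p \<in> {\<lambda>f r. until (x f) (y f) r | x y. x \<in> fut P n \<and> y \<in> fut P n}"
    then obtain x y where "x \<in> fut P n" "y \<in> fut P n" "p = (\<lambda>f r. until (x f) (y f) r)" by blast
    moreover from this have "\<exists>M>L. (\<lambda>f r. until (x f) (y f) (r + M)) \<in> C" for L
      by (intro Suc.prems[of n]) auto
    ultimately show "p \<in> W" using IH by (auto intro!: W_until)
  qed
qed

text \<open>Here the class supplies its own shifts, since each until of lower level belongs to level
  \<open>n\<close> and levels are closed under rational shifts.\<close>

lemma fut_W: "p \<in> fut P n \<Longrightarrow> p \<in> extends_bounded.W (fut P n) P"
proof (rule subsetD[OF fut_subset_W[OF fut.extends_bounded_axioms]])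
  fix x y m and L :: real assume m: "m < n" and xy: "x \<in> fut P m" "y \<in> fut P m"
  obtain M :: nat where "real M > L" using reals_Archimedean2 by blast
  moreover have "(\<lambda>f r. until (x f) (y f) r) \<in> fut P n"
    using fut_until[OF xy] fut_mono[of "Suc m" n P] m by (auto simp del: fut.simps)
  then have "(\<lambda>f r. until (x f) (y f) (r + real M)) \<in> fut P n"
    using fut_shift[of "real M" "\<lambda>f r. until (x f) (y f) r"] by simp
  ultimately show "\<exists>M>L. (\<lambda>f r. until (x f) (y f) (r + M)) \<in> fut P n" by blast
qed

text \<open>This provides the left limits demanded by \<open>adjoin_since\<close>. In reversed time
  the left limit is a negated bounded until over a future formula, and \<open>fut_W\<close> shows
  that bounded untils do not lead out of level \<open>n\<close>.\<close>

lemma acc_left_reversal_fut: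
  assumes "x \<in> reversal ` fut P n"
  shows "(\<lambda>f r. acc_left (\<lambda>u. \<not> x f u) r) \<in> reversal ` fut P n"
proof -
  have x: "reversal x \<in> fut P n" using assms by (simp add: in_reversal_image_iff)
  have "(\<lambda>f r. until_in {0<..1} (reversal x f) (\<lambda>_. True) r) \<in> extends_bounded.W (fut P n) P"
    by (intro fut.W_until_in fut_W x fut.tt mtl_interval_Ioc) auto
  then have "(\<lambda>f r. until_in {0<..1} (reversal x f) (\<lambda>_. True) r) \<in> fut P n"
    by (rule fut.W_subset)
  then have "(\<lambda>f r. \<not> until_in {0<..1} (reversal x f) (\<lambda>_. True) r) \<in> fut P n" by (rule fut.neg)
  also have "(\<lambda>f r. \<not> until_in {0<..1} (reversal x f) (\<lambda>_. True) r) =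
    reversal (\<lambda>f r. acc_left (\<lambda>u. \<not> x f u) r)"
    using reversal_since_in[of "{0<..1}" x "\<lambda>f r. True"]
    by (simp add: acc_left_iff_not_since_in reversal_def fun_eq_iff)
  finally show ?thesis by (simp add: in_reversal_image_iff)
qed

text \<open>Each step applies \<open>adjoin_since\<close> to the class reached so far, which
  contains \<open>C\<close> and hence the arguments of the next since together with the left limits.
  The upper bound on \<open>D\<close> records that only Boolean combinations have been
  added.\<close>

lemma adjoin_finite_sinces:
  assumes "finite H" "until_closed C"
    "\<And>p. p \<in> H \<Longrightarrow> \<exists>x\<in>C. \<exists>y\<in>C. (\<lambda>f r. acc_left (\<lambda>u. \<not> x f u) r) \<in> C \<and> p = (\<lambda>f r. since (x f) (y f) r)"
  shows "\<exists>D. until_closed D \<and> C \<subseteq> D \<and> H \<subseteq> D \<and> D \<subseteq> bool_closure (C \<union> H)"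
  using assms(1,3)
proof (induction rule: finite_induct)
  case empty
  then show ?case using assms(2) by (intro exI[of _ C]) (auto intro: bool_closure.base)
next
  case (insert p H)
  then obtain D where D: "until_closed D" "C \<subseteq> D" "H \<subseteq> D" "D \<subseteq> bool_closure (C \<union> H)" by auto
  obtain x y where xy: "x \<in> C" "y \<in> C" "(\<lambda>f r. acc_left (\<lambda>u. \<not> x f u) r) \<in> C"
    and p: "p = (\<lambda>f r. since (x f) (y f) r)" using insert.prems by blast
  interpret D: adjoin_since D x y
    using D(1,2) xy by (intro adjoin_since.intro adjoin_since_axioms.intro) auto
  have DC: "D \<subseteq> bool_closure (C \<union> insert p H)" using D(4) bool_closure_mono[of "C \<union> H" "C \<union> insert p H"] by blast
  have "D.D \<subseteq> bool_closure (C \<union> insert p H)"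
  proof
    fix d assume "d \<in> D.D"
    then obtain c e where ce: "c \<in> D" "e \<in> D"
      and d: "d = (\<lambda>f r. if since (x f) (y f) r then c f r else e f r)"
      by (rule D.D_cases)
    have "p \<in> bool_closure (C \<union> insert p H)" by (intro bool_closure.base) simp
    then show "d \<in> bool_closure (C \<union> insert p H)" unfolding d p using ce DC[unfolded p] by (intro bool_closure.cond) auto
  qed
  then show ?case
    using D(2,3) D.C_sub_D D.since_D D.D.until_closed_axioms p by (intro exI[of _ D.D]) auto
qed

definition Fut :: "'p set \<Rightarrow> 'p sem set" where
  "Fut P = (\<Union>n. fut P n)"

lemma Fut_I: "p \<in> fut P n \<Longrightarrow> p \<in> Fut P"
  unfolding Fut_def by blast

lemma Fut_common:
  assumes "p \<in> Fut P" "q \<in> Fut P"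
  obtains n where "p \<in> fut P n" "q \<in> fut P n"
proof -
  obtain m n where "p \<in> fut P m" "q \<in> fut P n" using assms unfolding Fut_def by blast
  then show ?thesis using that[of "max m n"] fut_mono[of m "max m n" P] fut_mono[of n "max m n" P] by auto
qed

interpretation Fut: until_closed "Fut P" for P
proof
  show "(\<lambda>f r. True) \<in> Fut P" by (rule Fut_I[OF fut.tt])
  fix p assume p: "p \<in> Fut P"
  then show "(\<lambda>f r. \<not> p f r) \<in> Fut P" unfolding Fut_def using fut.neg by blast
  fix q assume "q \<in> Fut P"
  with p obtain n where "p \<in> fut P n" "q \<in> fut P n" by (rule Fut_common)
  note fut.conj[OF this] fut_until[OF this]
  then show "(\<lambda>f r. p f r \<and> q f r) \<in> Fut P" "(\<lambda>f r. until (p f) (q f) r) \<in> Fut P"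
    by (blast intro: Fut_I)+
qed

text \<open>Induction on the level of the past formulas. At level 0 reversal adds nothing, because
  bounded formulas are closed under it. At the next level the new generators are since predicates
  whose arguments already lie in the previous class \<open>C\<close>.\<close>

lemma until_closed_bool_closure_fut: "until_closed (bool_closure (Fut P \<union> reversal ` fut P n))"
proof (induction n)
  case 0
  have "bounded_sem P \<subseteq> Fut P" unfolding Fut_def using fut.bounded_sem_subset by blast
  then have "Fut P \<union> reversal ` fut P 0 = Fut P" by auto
  moreover have "bool_closure (Fut P) = Fut P"
    using bool_closure_least[OF Fut.bool_closed_axioms subset_refl] bool_closure_superset by blast
  ultimately show ?case using Fut.until_closed_axioms by metis
next
  case (Suc n)
  define C where "C = bool_closure (Fut P \<union> reversal ` fut P n)"
  define H where "H = {\<lambda>f r. since (x f) (y f) r | x y. x \<in> reversal ` fut P n \<and> y \<in> reversal ` fut P n}"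
  have past_C: "reversal ` fut P n \<subseteq> C" and Fut_C: "Fut P \<subseteq> C" unfolding C_def by (auto intro: bool_closure.base)
  have rev_H: "reversal ` {\<lambda>f r. until (x f) (y f) r | x y. x \<in> fut P n \<and> y \<in> fut P n} \<subseteq> H"
    unfolding H_def by (fastforce simp: reversal_until)
  have H_rev: "H \<subseteq> reversal ` fut P (Suc n)"
  proof
    fix p assume "p \<in> H"
    then obtain x y where xy: "reversal x \<in> fut P n" "reversal y \<in> fut P n"
      and p: "p = (\<lambda>f r. since (x f) (y f) r)"
      unfolding H_def in_reversal_image_iff by blast
    show "p \<in> reversal ` fut P (Suc n)"
      unfolding in_reversal_image_iff p reversal_since using xy by (rule fut_until)
  qed
  have eq: "bool_closure (Fut P \<union> reversal ` fut P (Suc n)) = bool_closure (C \<union> H)"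
  proof (intro antisym bool_closure_subset_bool_closure Un_least)
    show "Fut P \<subseteq> bool_closure (C \<union> H)" using Fut_C bool_closure_superset[of "C \<union> H"] by blast
    have "reversal ` fut P (Suc n) \<subseteq> bool_closure (reversal ` fut P n \<union> H)"
      unfolding fut.simps reversal_bool_closure image_Un using rev_H by (intro bool_closure_mono) blast
    also have "\<dots> \<subseteq> bool_closure (C \<union> H)" using past_C by (intro bool_closure_mono) blast
    finally show "reversal ` fut P (Suc n) \<subseteq> bool_closure (C \<union> H)" .
    show "C \<subseteq> bool_closure (Fut P \<union> reversal ` fut P (Suc n))"
      unfolding C_def using fut_mono[of n "Suc n" P] by (intro bool_closure_mono) (auto simp del: fut.simps)
    show "H \<subseteq> bool_closure (Fut P \<union> reversal ` fut P (Suc n))" using H_rev bool_closure_superset by blast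
  qed
  show ?case unfolding eq
  proof (intro until_closed.intro until_closed_axioms.intro bool_closure.bool_closed_axioms)
    fix p q assume pq: "p \<in> bool_closure (C \<union> H)" "q \<in> bool_closure (C \<union> H)"
    obtain Hp where Hp: "finite Hp" "Hp \<subseteq> H" "p \<in> bool_closure (C \<union> Hp)" using pq(1) by (rule bool_closure_finite_support)
    obtain Hq where Hq: "finite Hq" "Hq \<subseteq> H" "q \<in> bool_closure (C \<union> Hq)" using pq(2) by (rule bool_closure_finite_support)
    \<comment> \<open>The two arguments together involve finitely many since predicates. Adjoining
      just these gives an until-closed class that contains both arguments and stays inside the
      target class.\<close>
    have "\<exists>D. until_closed D \<and> C \<subseteq> D \<and> Hp \<union> Hq \<subseteq> D \<and> D \<subseteq> bool_closure (C \<union> (Hp \<union> Hq))"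
    proof (rule adjoin_finite_sinces)
      show "until_closed C" unfolding C_def by (rule Suc.IH)
      fix p assume "p \<in> Hp \<union> Hq"
      then obtain x y where "x \<in> reversal ` fut P n" "y \<in> reversal ` fut P n" "p = (\<lambda>f r. since (x f) (y f) r)"
        using Hp(2) Hq(2) unfolding H_def by blast
      then show "\<exists>x\<in>C. \<exists>y\<in>C. (\<lambda>f r. acc_left (\<lambda>u. \<not> x f u) r) \<in> C \<and> p = (\<lambda>f r. since (x f) (y f) r)"
        using acc_left_reversal_fut[of x P n] past_C by blast
    qed (use Hp Hq in auto)
    then obtain D where D: "until_closed D" "C \<subseteq> D" "Hp \<union> Hq \<subseteq> D" "D \<subseteq> bool_closure (C \<union> (Hp \<union> Hq))" by blast
    interpret D: until_closed D by fact
    have "bool_closure (C \<union> Hp) \<subseteq> D" "bool_closure (C \<union> Hq) \<subseteq> D"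
      using D by (intro bool_closure_least D.bool_closed_axioms; blast)+
    then have "(\<lambda>f r. until (p f) (q f) r) \<in> D" using Hp(3) Hq(3) by (intro D.until) auto
    moreover have "bool_closure (C \<union> (Hp \<union> Hq)) \<subseteq> bool_closure (C \<union> H)" using Hp(2) Hq(2) by (intro bool_closure_mono) blast
    ultimately show "(\<lambda>f r. until (p f) (q f) r) \<in> bool_closure (C \<union> H)" using D(4) by blast
  qed
qed

section \<open>Separated predicates and their closure properties\<close>

definition separated :: "'p set \<Rightarrow> 'p sem set" where
  "separated P = bool_closure (Fut P \<union> reversal ` Fut P)"

lemma separated_level:
  assumes "p \<in> separated P"
  obtains n where "p \<in> bool_closure (Fut P \<union> reversal ` fut P n)"
proof -
  obtain H where H: "finite H" "H \<subseteq> reversal ` Fut P" "p \<in> bool_closure (Fut P \<union> H)"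
    using assms unfolding separated_def by (rule bool_closure_finite_support)
  have "\<exists>n. H \<subseteq> reversal ` fut P n" using H(1,2)
  proof (induction rule: finite_induct)
    case (insert h H)
    then obtain m n where "H \<subseteq> reversal ` fut P m" "h \<in> reversal ` fut P n" unfolding Fut_def by blast
    then show ?case using fut_mono[of m "max m n" P] fut_mono[of n "max m n" P]
      by (intro exI[of _ "max m n"]) fastforce
  qed simp
  then obtain n where "H \<subseteq> reversal ` fut P n" by blast
  then have "bool_closure (Fut P \<union> H) \<subseteq> bool_closure (Fut P \<union> reversal ` fut P n)" by (intro bool_closure_mono) blast
  then show ?thesis using that H(3) by blast
qed

lemma bool_closure_fut_subset_separated: "bool_closure (Fut P \<union> reversal ` fut P n) \<subseteq> separated P"
  unfolding separated_def Fut_def by (intro bool_closure_mono) blast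

lemma separated_reversal: "p \<in> separated P \<Longrightarrow> reversal p \<in> separated P"
proof -
  have "reversal ` separated P = separated P" unfolding separated_def by (simp add: reversal_bool_closure image_Un Un_commute)
  then show "p \<in> separated P \<Longrightarrow> reversal p \<in> separated P" by blast
qed

lemma separated_shift:
  assumes "p \<in> separated P" "q \<in> \<rat>"
  shows "(\<lambda>f r. p f (r + q)) \<in> separated P"
proof (rule bool_closure_image[where g = "\<lambda>f. f" and h = "\<lambda>r. r + q"])
  show "p \<in> bool_closure (Fut P \<union> reversal ` Fut P)" using assms unfolding separated_def by simp
  have Fut: "(\<lambda>f r. s f (r + q)) \<in> Fut P" if "s \<in> Fut P" "q \<in> \<rat>" for s q
    using that fut_shift unfolding Fut_def by blast
  fix s assume "s \<in> Fut P \<union> reversal ` Fut P"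
  then show "(\<lambda>f r. s f (r + q)) \<in> separated P"
  proof
    assume "s \<in> reversal ` Fut P"
    then have "(\<lambda>f r. reversal s f (r + - q)) \<in> Fut P"
      using assms(2) by (intro Fut) (auto simp: in_reversal_image_iff)
    then have "reversal (\<lambda>f r. s f (r + q)) \<in> Fut P" unfolding reversal_def by simp
    then have "(\<lambda>f r. s f (r + q)) \<in> reversal ` Fut P" by (simp add: in_reversal_image_iff)
    then show ?thesis unfolding separated_def by (blast intro: bool_closure.base)
  qed (use Fut assms(2) in \<open>auto simp: separated_def intro: bool_closure.base\<close>)
qed (simp add: separated_def bool_closure.bool_closed_axioms)

lemma windowed_reversal:
  assumes "p \<in> windowed P D L"
  shows "reversal p \<in> windowed P (reversal ` D) L"
  using assms
proof (cases rule: windowedE)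
  case (1 S)
  show ?thesis
  proof (rule windowedI[where S = "(\<lambda>(X, \<beta>). (reversal X, reversal \<beta>)) ` S"])
    show "finite ((\<lambda>(X, \<beta>). (reversal X, reversal \<beta>)) ` S)" using 1(1) by simp
    fix X \<beta> assume "(X, \<beta>) \<in> (\<lambda>(X, \<beta>). (reversal X, reversal \<beta>)) ` S"
    then have S: "(reversal X, reversal \<beta>) \<in> S" by auto
    then show "X \<in> reversal ` D" "\<beta> \<in> bounded_sem P"
      using 1(2,3)[OF S] reversal_bounded_sem_mem[of "reversal \<beta>"] by (auto simp: in_reversal_image_iff)
    fix f :: "real \<Rightarrow> 'a set" and r u assume "X f r" "\<bar>u - r\<bar> \<le> L"
    then show "reversal p f u = \<beta> f u"
      using 1(5)[OF S, of "\<lambda>t. f (- t)" "- r" "- u"] by (auto simp: reversal_def)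
  next
    fix f :: "real \<Rightarrow> 'a set" and r
    obtain X \<beta> where "(X, \<beta>) \<in> S" "X (\<lambda>t. f (- t)) (- r)" using 1(4) by blast
    then show "\<exists>X \<beta>. (X, \<beta>) \<in> (\<lambda>(X, \<beta>). (reversal X, reversal \<beta>)) ` S \<and> X f r"
      by (intro exI[of _ "reversal X"] exI[of _ "reversal \<beta>"]) (force simp: reversal_def)
  qed
qed

interpretation separated: until_closed "separated P" for P
proof (intro until_closed.intro until_closed_axioms.intro)
  show "bool_closed (separated P)" unfolding separated_def by (rule bool_closure.bool_closed_axioms)
  fix p q assume "p \<in> separated P" and "q \<in> separated P"
  obtain m where m: "p \<in> bool_closure (Fut P \<union> reversal ` fut P m)" using \<open>p \<in> separated P\<close> by (rule separated_level)
  obtain n where n: "q \<in> bool_closure (Fut P \<union> reversal ` fut P n)" using \<open>q \<in> separated P\<close> by (rule separated_level)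
  have "bool_closure (Fut P \<union> reversal ` fut P k) \<subseteq> bool_closure (Fut P \<union> reversal ` fut P (max m n))" if "k \<le> max m n" for k
    using fut_mono[OF that, of P] by (intro bool_closure_mono) blast
  from this[of m] this[of n] m n
  have "(\<lambda>f r. until (p f) (q f) r) \<in> bool_closure (Fut P \<union> reversal ` fut P (max m n))"
    by (intro until_closed.until[OF until_closed_bool_closure_fut]) auto
  then show "(\<lambda>f r. until (p f) (q f) r) \<in> separated P" using bool_closure_fut_subset_separated by blast
qed

interpretation separated: extends_bounded "separated P" P for P
proof
  show "bounded_sem P \<subseteq> separated P"
    unfolding separated_def Fut_def using fut.bounded_sem_subset[of P 0] by (blast intro: bool_closure.base)
qed

text \<open>For future formulas the windows come from \<open>fut_W\<close> after enlarging the class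
  of deciding predicates. Past formulas follow by reflection, because \<open>separated P\<close> is
  closed under reversal.\<close>

lemma separated_W: "p \<in> separated P \<Longrightarrow> p \<in> extends_bounded.W (separated P) P"
proof -
  have fut_separated: "fut P n \<subseteq> separated P" for n unfolding separated_def Fut_def by (blast intro: bool_closure.base)
  have Fut: "Fut P \<subseteq> extends_bounded.W (separated P) P"
    using W_mono[OF fut.extends_bounded_axioms separated.extends_bounded_axioms fut_separated] fut_W
    unfolding Fut_def by blast
  have rev: "reversal p \<in> extends_bounded.W (separated P) P" if "p \<in> extends_bounded.W (separated P) P" for p
  proof (rule separated.W_I)
    fix L
    have "reversal ` separated P \<subseteq> separated P" using separated_reversal by blast
    then show "reversal p \<in> windowed P (separated P) L"
      using windowed_reversal[OF separated.W_windowed[OF that]] windowed_mono by blast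
  qed
  have "separated P \<subseteq> extends_bounded.W (separated P) P"
    unfolding separated_def[of P] using Fut rev by (intro bool_closure_least) (auto simp: separated_def[symmetric] intro: separated.W.bool_closed_axioms)
  then show "p \<in> separated P \<Longrightarrow> p \<in> extends_bounded.W (separated P) P" by blast
qed

section \<open>Normal form\<close>

text \<open>The distance constraint is removed by cutting at \<open>r + q\<close>: a bounded
  condition says that \<open>a\<close> holds up to and including that point, and a plain until
  starts from there.\<close>

lemma until_in_Ioi:
  assumes "0 < q"
  shows "until_in {q<..} a b r \<longleftrightarrow> \<not> until_in {0<..q} (\<lambda>_. True) (\<lambda>u. \<not> a u) r \<and> until a b (r + q)"
proof
  assume "until_in {q<..} a b r"
  then obtain t where "t > r + q" "b t" "\<forall>u. r < u \<and> u < t \<longrightarrow> a u" unfolding until_in_def by (auto simp: less_diff_eq add.commute)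
  then show "\<not> until_in {0<..q} (\<lambda>_. True) (\<lambda>u. \<not> a u) r \<and> until a b (r + q)"
    using assms unfolding until_in_def until_def by (auto intro!: exI[of _ t])
next
  assume "\<not> until_in {0<..q} (\<lambda>_. True) (\<lambda>u. \<not> a u) r \<and> until a b (r + q)"
  then obtain t where t: "t > r + q" "b t" "\<forall>u. r + q < u \<and> u < t \<longrightarrow> a u"
    and a: "\<And>u. r < u \<Longrightarrow> u - r \<le> q \<Longrightarrow> a u"
    unfolding until_in_def until_def by force
  have "a u" if "r < u" "u < t" for u using a[of u] t(3) that by (cases "u \<le> r + q") auto
  then show "until_in {q<..} a b r" using t assms unfolding until_in_def by (intro exI[of _ t]) auto
qed

lemma until_in_Ici: "until_in {q..} a b r \<longleftrightarrow> until_in {q} a b r \<or> until_in {q<..} a b r"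
  unfolding until_in_def by (force simp: order_le_less)

text \<open>Bounded intervals are handled by the window argument. An unbounded one is a ray, which
  reduces to a shifted plain until and bounded operators.\<close>

lemma separated_until_in:
  assumes "p \<in> separated P" "s \<in> separated P" "mtl_interval I"
  shows "(\<lambda>f r. until_in I (p f) (s f) r) \<in> separated P"
proof -
  have bdd: "(\<lambda>f r. until_in J (p f) (s f) r) \<in> separated P"
    if "p \<in> separated P" "s \<in> separated P" "mtl_interval J" "bounded J" for p s J
    using that by (intro separated.W_subset[OF separated.W_until_in[OF separated_W separated_W]])
  have Ioi: "(\<lambda>f r. until_in {q<..} (p f) (s f) r) \<in> separated P" if "q \<in> \<rat>" "q \<ge> 0" for q
  proof (cases "q = 0")
    case True
    then show ?thesis using separated.until[OF assms(1,2)] by (simp add: until_iff_until_in)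
  next
    case False
    then have "q > 0" using that by simp
    then show ?thesis unfolding until_in_Ioi[OF \<open>q > 0\<close>]
      using separated_shift[OF separated.until[OF assms(1,2)] that(1)] that(1)
      by (intro separated.conj separated.neg bdd separated.tt assms mtl_interval_Ioc bounded_Ioc)
  qed
  show ?thesis
  proof (cases "bounded I")
    case True
    then show ?thesis using bdd assms by blast
  next
    case False
    with assms(3) show ?thesis
    proof (cases rule: unbounded_mtl_interval_cases)
      case (1 q)
      then show ?thesis using Ioi by simp
    next
      case (2 q)
      then show ?thesis unfolding 2(3) until_in_Ici
        by (intro separated.disj Ioi bdd assms mtl_interval_singleton) auto
    qed
  qed
qed

text \<open>Structural induction; the since case is the until case read backwards in time.\<close>

lemma mtl_separated: "\<phi> \<in> mtl P \<Longrightarrow> (\<lambda>f r. sat f r \<phi>) \<in> separated P"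
proof (induction rule: mtl.induct)
  case TT
  then show ?case using separated.tt by simp
next
  case (Atom p)
  then have "(\<lambda>f r. sat f r (Atom p)) \<in> bounded_sem P" by (intro bounded_semI[of "Atom p"]) (auto intro: mtl.Atom)
  then show ?case using separated.bounded_sem_subset by blast
next
  case (And \<phi> \<psi>)
  then show ?case using separated.conj by simp
next
  case (Neg \<phi>)
  then show ?case using separated.neg by simp
next
  case (Until \<phi> \<psi> I)
  then show ?case unfolding sat_Until_iff by (intro separated_until_in)
next
  case (Since \<phi> \<psi> I)
  then have "reversal (\<lambda>f r. until_in I (reversal (\<lambda>f r. sat f r \<phi>) f) (reversal (\<lambda>f r. sat f r \<psi>) f) r) \<in> separated P"
    by (intro separated_reversal separated_until_in)
  then show ?case unfolding sat_Since_iff reversal_until_in by simp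
qed

section \<open>Finite past-reach of future formulas\<close>

lemma inf_endpoint_nonneg: "mtl_interval I \<Longrightarrow> 0 \<le> inf_endpoint I"
  unfolding mtl_interval_def inf_endpoint_def by (auto intro!: Inf_greatest)

lemma sup_endpoint_less_top:
  assumes "bounded I" "mtl_interval I"
  shows "sup_endpoint I < \<infinity>"
proof -
  obtain K where "I \<subseteq> {0<..K}" using assms by (rule bounded_mtl_interval)
  then have "sup_endpoint I \<le> ereal K" unfolding sup_endpoint_def by (auto intro!: Sup_least)
  then show ?thesis by (auto simp: less_top)
qed

lemma pr_Until_less_top:
  assumes "mtl_interval I" "pr \<phi> < \<infinity>" "pr \<psi> < \<infinity>"
  shows "pr (Until \<phi> I \<psi>) < \<infinity>"
proof -
  have "pr \<psi> - inf_endpoint I < \<infinity>"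
    using inf_endpoint_nonneg[OF assms(1)] assms(3) by (cases "pr \<psi>"; cases "inf_endpoint I") auto
  then show ?thesis using assms(2) by (simp add: max_def)
qed

lemma pr_bounded_intervals_less_top:
  "\<phi> \<in> mtl P \<Longrightarrow> bounded_intervals \<phi> \<Longrightarrow> pr \<phi> < \<infinity>"
proof (induction rule: mtl.induct)
  case (Until \<phi> \<psi> I)
  then show ?case by (intro pr_Until_less_top) auto
next
  case (Since \<phi> \<psi> I)
  then show ?case using sup_endpoint_less_top[of I] by (auto simp: max_def)
qed (auto simp: max_def)

text \<open>Bounded formulas have finite past-reach, and an unbounded until keeps it finite because
  only its infimum enters \<open>pr\<close>. The truth functions of such formulas therefore form a
  class closed under the operations that build \<open>fut\<close>.\<close>

lemma fut_formula:
  assumes "p \<in> fut P n"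
  shows "\<exists>\<phi>\<in>mtl P. pr \<phi> < \<infinity> \<and> p = (\<lambda>f r. sat f r \<phi>)"
proof -
  define F where "F = (\<lambda>\<phi> f r. sat f r \<phi>) ` {\<phi> \<in> mtl P. pr \<phi> < \<infinity>}"
  have F_I: "p \<in> F" if "\<phi> \<in> mtl P" "pr \<phi> < \<infinity>" "p = (\<lambda>f r. sat f r \<phi>)" for p \<phi>
    using that unfolding F_def by blast
  have F_E: "\<exists>\<phi>\<in>mtl P. pr \<phi> < \<infinity> \<and> p = (\<lambda>f r. sat f r \<phi>)" if "p \<in> F" for p
    using that unfolding F_def by blast
  have bool: "bool_closed F"
  proof
    show "(\<lambda>f r. True) \<in> F" by (rule F_I[of TT]) (auto intro: mtl.TT)
    fix p assume "p \<in> F"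
    then obtain \<phi> where \<phi>: "\<phi> \<in> mtl P" "pr \<phi> < \<infinity>" "p = (\<lambda>f r. sat f r \<phi>)" using F_E by blast
    then show "(\<lambda>f r. \<not> p f r) \<in> F" by (intro F_I[of "Neg \<phi>"]) (auto intro: mtl.Neg)
    fix q assume "q \<in> F"
    then obtain \<psi> where "\<psi> \<in> mtl P" "pr \<psi> < \<infinity>" "q = (\<lambda>f r. sat f r \<psi>)" using F_E by blast
    with \<phi> show "(\<lambda>f r. p f r \<and> q f r) \<in> F" by (intro F_I[of "And \<phi> \<psi>"]) (auto intro: mtl.And simp: max_def)
  qed
  have until: "(\<lambda>f r. until (x f) (y f) r) \<in> F" if xy: "x \<in> F" "y \<in> F" for x y
  proof -
    obtain \<phi> where "\<phi> \<in> mtl P" "pr \<phi> < \<infinity>" "x = (\<lambda>f r. sat f r \<phi>)" using F_E[OF xy(1)] by blast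
    moreover obtain \<psi> where "\<psi> \<in> mtl P" "pr \<psi> < \<infinity>" "y = (\<lambda>f r. sat f r \<psi>)" using F_E[OF xy(2)] by blast
    ultimately show ?thesis
      by (intro F_I[of "Until \<phi> {0<..} \<psi>"] mtl.Until pr_Until_less_top mtl_interval_Ioi)
        (auto simp: until_iff_until_in sat_Until_iff simp del: sat.simps)
  qed
  have "fut P n \<subseteq> F"
  proof (induction n)
    case 0
    then show ?case by (auto elim!: bounded_semE intro!: F_I pr_bounded_intervals_less_top)
  next
    case (Suc n)
    then show ?case unfolding fut.simps using until by (intro bool_closure_least bool) blast
  qed
  then show ?thesis using F_E assms by blast
qed

section \<open>From separated predicates to the three kinds of formulas\<close>

definition generators :: "'p set \<Rightarrow> 'p fm set" where
  "generators P =
     {Dia {real_of_rat N} \<theta> | N \<theta>. 0 \<le> N \<and> \<theta> \<in> mtl P \<and> pr \<theta> < ereal (real_of_rat N - 1)} \<union>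
     {Past_Dia {real_of_rat N} \<theta> | N \<theta>. 0 \<le> N \<and> \<theta> \<in> mtl P \<and> fr \<theta> < ereal (real_of_rat N - 1)} \<union>
     {\<theta> \<in> mtl P. bounded_intervals \<theta>}"

lemma mirror_generators: "\<phi> \<in> generators P \<Longrightarrow> mirror \<phi> \<in> generators P"
  unfolding generators_def using mirror_mtl[of _ P] by (fastforce simp: Dia_def Past_Dia_def)

definition generated :: "'p set \<Rightarrow> 'p sem set" where
  "generated P = bool_closure ((\<lambda>\<phi> f r. sat f r \<phi>) ` generators P)"

lemma generated_reversal: "p \<in> generated P \<Longrightarrow> reversal p \<in> generated P"
proof -
  have "reversal ` (\<lambda>\<phi> f r. sat f r \<phi>) ` generators P \<subseteq> (\<lambda>\<phi> f r. sat f r \<phi>) ` generators P"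
    using mirror_generators by (fastforce simp: sem_mirror[symmetric])
  then have "reversal ` generated P \<subseteq> generated P" unfolding generated_def reversal_bool_closure by (rule bool_closure_mono)
  then show "p \<in> generated P \<Longrightarrow> reversal p \<in> generated P" by blast
qed

interpretation generated: extends_bounded "generated P" P for P
proof (intro extends_bounded.intro extends_bounded_axioms.intro)
  show "bool_closed (generated P)" unfolding generated_def by (rule bool_closure.bool_closed_axioms)
  show "bounded_sem P \<subseteq> generated P"
    unfolding generated_def bounded_sem_def generators_def by (auto intro: bool_closure.base)
qed

text \<open>The until has finite past-reach, so its value far enough ahead is a generator of the
  first kind. This is the hypothesis of \<open>fut_subset_W\<close> for the class
  \<open>generated P\<close>.\<close>

lemma generated_until_shift:
  assumes x: "x \<in> fut P m" and y: "y \<in> fut P m"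
  shows "\<exists>M>L. (\<lambda>f r. until (x f) (y f) (r + M)) \<in> generated P"
proof -
  obtain \<theta> where \<theta>: "\<theta> \<in> mtl P" "pr \<theta> < \<infinity>" "(\<lambda>f r. until (x f) (y f) r) = (\<lambda>f r. sat f r \<theta>)"
    using fut_formula[OF fut_until[OF x y]] by blast
  obtain n :: nat where n: "pr \<theta> < ereal (real n)" using less_PInf_Ex_of_nat[of "pr \<theta>"] \<theta>(2) by auto
  obtain k :: nat where k: "L < real k" using reals_Archimedean2 by blast
  \<comment> \<open>The summand \<open>n\<close> dominates the past-reach and \<open>k\<close>
    exceeds \<open>L\<close>. The additional 1 compensates the 1 subtracted in the side condition,
    \<open>M - 1\<close> being \<open>n + k\<close>, and makes \<open>M\<close> positive.\<close>
  define M where "M = n + k + 1"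
  have "M > 0" unfolding M_def by simp
  have "pr \<theta> < ereal (real M - 1)" using n by (rule less_le_trans) (simp add: M_def)
  then have "Dia {real_of_rat (of_nat M)} \<theta> \<in> generators P"
    unfolding generators_def using \<theta>(1) by (intro UnI1 CollectI exI[of _ "of_nat M"] exI[of _ \<theta>]) auto
  then have "(\<lambda>f r. sat f r (Dia {real_of_rat (of_nat M)} \<theta>)) \<in> generated P" unfolding generated_def by (blast intro: bool_closure.base)
  also have "(\<lambda>f r. sat f r (Dia {real_of_rat (of_nat M)} \<theta>)) = (\<lambda>f r. sat f (r + real M) \<theta>)"
    using \<open>M > 0\<close> unfolding Dia_def sat_Until_iff by (simp add: until_in_singleton)
  also have "\<dots> = (\<lambda>f r. until (x f) (y f) (r + real M))" using \<theta>(3) by (simp add: fun_eq_iff)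
  finally show ?thesis using k by (intro exI[of _ "real M"]) (simp add: M_def)
qed

text \<open>Future formulas have windows decided by \<open>generated P\<close>, and evaluating at
  the centre places them in that class. Past formulas follow because mirroring permutes the
  generators.\<close>

lemma separated_subset_generated: "separated P \<subseteq> generated P"
proof -
  have "fut P n \<subseteq> generated P" for n
  proof
    fix p assume p: "p \<in> fut P n"
    have "fut P n \<subseteq> extends_bounded.W (generated P) P"
      by (rule fut_subset_W[OF generated.extends_bounded_axioms]) (rule generated_until_shift)
    then show "p \<in> generated P" using p by (intro generated.W_subset) auto
  qed
  then have "Fut P \<subseteq> generated P" unfolding Fut_def by blast
  moreover from this have "reversal ` Fut P \<subseteq> generated P" using generated_reversal by blast
  ultimately show ?thesis unfolding separated_def by (intro bool_closure_least generated.bool_closed_axioms Un_least)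
qed

lemma generated_boolean_combination:
  assumes "p \<in> generated P"
  shows "\<exists>\<psi>\<in>boolean_combinations (generators P). p = (\<lambda>f r. sat f r \<psi>)"
  using assms unfolding generated_def
proof induction
  case (base p)
  then show ?case by (auto intro: boolean_combinations.base)
next
  case top
  \<comment> \<open>Syntactic Boolean combinations have no constant of their own; truth enters as a
    formula without temporal operators, which is of the third kind.\<close>
  have "TT \<in> boolean_combinations (generators P)"
    by (intro boolean_combinations.base) (auto simp: generators_def intro: mtl.TT)
  then show ?case by (intro bexI[of _ TT]) auto
next
  case (compl p)
  then obtain \<psi> where "\<psi> \<in> boolean_combinations (generators P)" "p = (\<lambda>f r. sat f r \<psi>)" by blast
  then show ?case by (intro bexI[of _ "Neg \<psi>"]) (auto intro: boolean_combinations.Neg)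
next
  case (inter p q)
  then obtain \<psi> \<psi>' where "\<psi> \<in> boolean_combinations (generators P)" "p = (\<lambda>f r. sat f r \<psi>)"
    "\<psi>' \<in> boolean_combinations (generators P)" "q = (\<lambda>f r. sat f r \<psi>')" by blast
  then show ?case by (intro bexI[of _ "And \<psi> \<psi>'"]) (auto intro: boolean_combinations.And)
qed

theorem theorem3:
  fixes P :: "'p set" and \<phi> :: "'p fm"
  assumes "finite P" and "\<phi> \<in> mtl P"
  shows "\<exists>\<psi> \<in> boolean_combinations
           ({Dia {real_of_rat N} \<theta> | N \<theta>. 0 \<le> N \<and> \<theta> \<in> mtl P \<and> pr \<theta> < ereal (real_of_rat N - 1)} \<union>
            {Past_Dia {real_of_rat N} \<theta> | N \<theta>. 0 \<le> N \<and> \<theta> \<in> mtl P \<and> fr \<theta> < ereal (real_of_rat N - 1)} \<union>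
            {\<theta> \<in> mtl P. bounded_intervals \<theta>}).
         equivalent P \<phi> \<psi>"
proof -
  have "(\<lambda>f r. sat f r \<phi>) \<in> generated P" using mtl_separated[OF assms(2)] separated_subset_generated by blast
  then obtain \<psi> where "\<psi> \<in> boolean_combinations (generators P)" "(\<lambda>f r. sat f r \<phi>) = (\<lambda>f r. sat f r \<psi>)"
    using generated_boolean_combination by blast
  then show ?thesis unfolding generators_def equivalent_def by (intro bexI[of _ \<psi>]) (simp add: fun_eq_iff)
qed

end
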